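(* Let $(G,\nu)$ be a computable group with $\nu$ injective. The set $\mathfrak{F}_{seq}(G)$ of (indices of) all computable F\o lner sequences of $(G,\nu)$ belongs to the class $\Pi^0_3$. Moreover, for the abelian group $G=\bigoplus_{n\in\omega}\mathbb{Z}$ (with its standard computable numbering) the set $\mathfrak{F}_{seq}(G)$ is $\Pi^0_3$-complete.
   Context: An enumerated group is a group $(\mathbb{N},\star,{}^{-1},1)$ with underlying set $\mathbb{N}$. $(G,\nu)$ is a computable group with injective $\nu$ if $\nu:(\mathbb{N},\star,{}^{-1},1)\to G$ is a group isomorphism from an enumerated group whose operations $\star,{}^{-1}$ are computable functions (so equality of elements of $G$ given by group words in numbers is decidable). One identifies $G$ with $\mathbb{N}$ and finite subsets of $G$ with finite subsets of $\mathbb{N}$, which are coded by G\"odel numbers. A sequence $(F_j)_{j\in\mathbb{N}}$ of non-empty finite subsets of $G$ is a F\o lner sequence if $\lim_{j\to\infty}\frac{|F_j\setminus gF_j|}{|F_j|}=0$ for every $g\in G$. A computable F\o lner sequence of $(G,\nu)$ is a computable sequence $(n_j)_{j\in\mathbb{N}}$ where each $n_j$ is the G\"odel number of some $F_j$ such that $(F_j)_{j\in\mathbb{N}}$ is a F\o lner sequence. Let $\varphi(x,y)$ be a universal partial recursive function and $\varphi_x(y)=\varphi(x,y)$. Computable F\o lner sequences are identified with numbers of recursive functions producing them: $\mathfrak{F}_{seq}(G)$ is the set of all $m\in\mathbb{N}$ such that $\varphi_m$ is total and $(\varphi_m(j))_{j\in\mathbb{N}}$ is a computable F\o lner sequence of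 $(G,\nu)$. $\Pi^0_3$ refers to the arithmetical hierarchy, and $\Pi^0_3$-complete is with respect to many-one reducibility. The standard computable numbering of $\bigoplus_{n\in\omega}\mathbb{Z}=\bigoplus_{n\in\omega}\langle g_n\rangle$ is the one coming from the usual coding of finitely supported integer sequences; in particular $n\mapsto\nu^{-1}(g_n)$ is computable.
   Formalization: For the completeness claim the universal partial recursive function is additionally assumed to be acceptable (to satisfy the s-m-n property); for a merely universal function completeness can fail, since all indices of total functions may lie in an immune set. *)

theory Defs
  imports Complex_Main "HOL-Library.Nat_Bijection" "HOL-Algebra.Product_Groups"
begin

definition prim_rec ::
  "(nat list \<rightharpoonup> nat) \<Rightarrow> (nat list \<rightharpoonup> nat) \<Rightarrow> nat \<Rightarrow> nat list \<Rightarrow> nat option" where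
  "prim_rec f g k xs = rec_nat (f xs) (\<lambda>j r. Option.bind r (\<lambda>v. g (j # v # xs))) k"

text \<open>Unbounded search diverges as soon as it meets an argument at which \<open>f\<close> is undefined.\<close>

definition mu_search :: "(nat list \<rightharpoonup> nat) \<Rightarrow> nat list \<Rightarrow> nat option" where
  "mu_search f xs =
     (if \<exists>k. f (k # xs) = Some 0 \<and> (\<forall>j<k. \<exists>v. f (j # xs) = Some (Suc v))
      then Some (LEAST k. f (k # xs) = Some 0) else None)"

text \<open>
  A \<open>k\<close>-ary partial function is given by its values on lists of length \<open>k\<close>; by the last rule
  its values on all other lists are irrelevant.
\<close>

inductive partial_recursive :: "nat \<Rightarrow> (nat list \<rightharpoonup> nat) \<Rightarrow> bool" where
  zero: "partial_recursive n (\<lambda>xs. Some 0)"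
| succ: "partial_recursive 1 (\<lambda>xs. Some (Suc (hd xs)))"
| proj: "i < n \<Longrightarrow> partial_recursive n (\<lambda>xs. Some (xs ! i))"
| comp: "partial_recursive (length gs) f \<Longrightarrow> (\<And>g. g \<in> set gs \<Longrightarrow> partial_recursive n g) \<Longrightarrow>
           partial_recursive n (\<lambda>xs. Option.bind (those (map (\<lambda>g. g xs) gs)) f)"
| prim: "partial_recursive n f \<Longrightarrow> partial_recursive (Suc (Suc n)) g \<Longrightarrow>
           partial_recursive (Suc n) (\<lambda>xs. prim_rec f g (hd xs) (tl xs))"
| mu:   "partial_recursive (Suc n) f \<Longrightarrow> partial_recursive n (mu_search f)"
| ext:  "partial_recursive n f \<Longrightarrow> (\<And>xs. length xs = n \<Longrightarrow> g xs = f xs) \<Longrightarrow>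
           partial_recursive n g"

definition partial_recursive1 :: "(nat \<rightharpoonup> nat) \<Rightarrow> bool" where
  "partial_recursive1 f \<longleftrightarrow> partial_recursive 1 (\<lambda>xs. f (xs ! 0))"

definition partial_recursive2 :: "(nat \<Rightarrow> nat \<rightharpoonup> nat) \<Rightarrow> bool" where
  "partial_recursive2 f \<longleftrightarrow> partial_recursive 2 (\<lambda>xs. f (xs ! 0) (xs ! 1))"

definition computable1 :: "(nat \<Rightarrow> nat) \<Rightarrow> bool" where
  "computable1 f \<longleftrightarrow> partial_recursive1 (\<lambda>x. Some (f x))"

definition computable2 :: "(nat \<Rightarrow> nat \<Rightarrow> nat) \<Rightarrow> bool" where
  "computable2 f \<longleftrightarrow> partial_recursive2 (\<lambda>x y. Some (f x y))"

definition universal_function :: "(nat \<Rightarrow> nat \<rightharpoonup> nat) \<Rightarrow> bool" where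
  "universal_function \<phi> \<longleftrightarrow>
     partial_recursive2 \<phi> \<and> (\<forall>f. partial_recursive1 f \<longrightarrow> (\<exists>x. \<phi> x = f))"

text \<open>
  A universal function is a Goedel (or acceptable) one if indices can be found effectively, that
  is, if the s-m-n property holds.  Completeness of index sets is sensitive to this: there are
  universal functions, such as Friedberg numberings, that are not acceptable.
\<close>

definition goedel_universal_function :: "(nat \<Rightarrow> nat \<rightharpoonup> nat) \<Rightarrow> bool" where
  "goedel_universal_function \<phi> \<longleftrightarrow> universal_function \<phi> \<and>
     (\<forall>\<psi>. partial_recursive2 \<psi> \<longrightarrow> (\<exists>s. computable1 s \<and> (\<forall>x. \<phi> (s x) = \<psi> x)))"

definition recursive_relation :: "nat \<Rightarrow> (nat list \<Rightarrow> bool) \<Rightarrow> bool" where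
  "recursive_relation k R \<longleftrightarrow> partial_recursive k (\<lambda>xs. Some (if R xs then 1 else 0))"

text \<open>Arguments: the level, the arity \<open>k\<close>, and the relation, of which only the lists of length \<open>k\<close> matter.\<close>

fun sigma_relation :: "nat \<Rightarrow> nat \<Rightarrow> (nat list \<Rightarrow> bool) \<Rightarrow> bool"
  and pi_relation :: "nat \<Rightarrow> nat \<Rightarrow> (nat list \<Rightarrow> bool) \<Rightarrow> bool" where
  "sigma_relation 0 k R \<longleftrightarrow> recursive_relation k R"
| "sigma_relation (Suc n) k R \<longleftrightarrow>
     (\<exists>S. pi_relation n (Suc k) S \<and> (\<forall>xs. length xs = k \<longrightarrow> (R xs \<longleftrightarrow> (\<exists>y. S (y # xs)))))"
| "pi_relation 0 k R \<longleftrightarrow> recursive_relation k R"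
| "pi_relation (Suc n) k R \<longleftrightarrow>
     (\<exists>S. sigma_relation n (Suc k) S \<and> (\<forall>xs. length xs = k \<longrightarrow> (R xs \<longleftrightarrow> (\<forall>y. S (y # xs)))))"

definition pi_sets :: "nat \<Rightarrow> nat set set" where
  "pi_sets n = {A. pi_relation n 1 (\<lambda>xs. xs ! 0 \<in> A)}"

definition many_one_reducible :: "nat set \<Rightarrow> nat set \<Rightarrow> bool" where
  "many_one_reducible A B \<longleftrightarrow> (\<exists>f. computable1 f \<and> (\<forall>x. x \<in> A \<longleftrightarrow> f x \<in> B))"

definition pi_complete :: "nat \<Rightarrow> nat set \<Rightarrow> bool" where
  "pi_complete n B \<longleftrightarrow> B \<in> pi_sets n \<and> (\<forall>A \<in> pi_sets n. many_one_reducible A B)"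

definition computable_enumerated_group :: "nat monoid \<Rightarrow> bool" where
  "computable_enumerated_group N \<longleftrightarrow> group N \<and> carrier N = UNIV \<and>
     computable2 (\<lambda>x y. x \<otimes>\<^bsub>N\<^esub> y) \<and> computable1 (\<lambda>x. inv\<^bsub>N\<^esub> x)"

definition computable_group :: "('a, 'b) monoid_scheme \<Rightarrow> (nat \<Rightarrow> 'a) \<Rightarrow> bool" where
  "computable_group G \<nu> \<longleftrightarrow> group G \<and> (\<exists>N. computable_enumerated_group N \<and> \<nu> \<in> iso N G)"

definition folner_sequence :: "('a, 'b) monoid_scheme \<Rightarrow> (nat \<Rightarrow> 'a set) \<Rightarrow> bool" where
  "folner_sequence G F \<longleftrightarrow>
     (\<forall>j. F j \<subseteq> carrier G \<and> finite (F j) \<and> F j \<noteq> {}) \<and>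
     (\<forall>g \<in> carrier G.
        (\<lambda>j. real (card (F j - (g <#\<^bsub>G\<^esub> F j))) / real (card (F j))) \<longlonglongrightarrow> 0)"

text \<open>Goedel numbers of finite sets of natural numbers are the canonical indices \<^const>\<open>set_encode\<close>.\<close>

definition computable_folner_sequence ::
  "('a, 'b) monoid_scheme \<Rightarrow> (nat \<Rightarrow> 'a) \<Rightarrow> (nat \<Rightarrow> nat) \<Rightarrow> bool" where
  "computable_folner_sequence G \<nu> n \<longleftrightarrow>
     computable1 n \<and> folner_sequence G (\<lambda>j. \<nu> ` set_decode (n j))"

definition folner_indices ::
  "(nat \<Rightarrow> nat \<rightharpoonup> nat) \<Rightarrow> ('a, 'b) monoid_scheme \<Rightarrow> (nat \<Rightarrow> 'a) \<Rightarrow> nat set" where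
  "folner_indices \<phi> G \<nu> =
     {m. \<exists>n. (\<forall>j. \<phi> m j = Some (n j)) \<and> computable_folner_sequence G \<nu> n}"

definition int_direct_sum :: "(nat \<Rightarrow> int) monoid" where
  "int_direct_sum = sum_group UNIV (\<lambda>_. integer_group)"

text \<open>
  Iterated pairing: the number \<open>prod_encode (b, int_encode z)\<close> codes the sequence with head \<open>z\<close>
  whose tail is coded by \<open>b\<close>.  Since \<open>prod_encode (0, int_encode 0) = 0\<close>, the number \<open>0\<close> codes
  the zero sequence, and every finitely supported sequence has exactly one code.
\<close>

definition int_seq_decode :: "nat \<Rightarrow> nat \<Rightarrow> int" where
  "int_seq_decode c i = int_decode (snd (prod_decode (((\<lambda>b. fst (prod_decode b)) ^^ i) c)))"

lemma int_seq_decode_0: "int_seq_decode c 0 = int_decode (snd (prod_decode c))"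
  by (simp add: int_seq_decode_def)

lemma int_seq_decode_Suc: "int_seq_decode c (Suc i) = int_seq_decode (fst (prod_decode c)) i"
  by (simp add: int_seq_decode_def funpow_Suc_right del: funpow.simps)

lemma fst_prod_decode_less: "c > 0 \<Longrightarrow> fst (prod_decode c) < c"
proof -
  assume "c > 0"
  obtain a b where ab: "prod_decode c = (a, b)" by fastforce
  then have c: "c = prod_encode (a, b)" by (metis prod_decode_inverse)
  have "a + b \<le> triangle (a + b)" by (cases "a + b") auto
  then have "2 * a + b \<le> c" by (simp add: c prod_encode_def)
  with \<open>c > 0\<close> have "a < c" by (cases a) auto
  with ab show ?thesis by simp
qed

lemma prod_decode_zero: "prod_decode 0 = (0, 0)"
  by (simp add: prod_decode_def prod_decode_aux.simps)

lemma int_decode_zero: "int_decode 0 = 0"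
  by (simp add: int_decode_def sum_decode_def)

lemma int_seq_decode_zero: "int_seq_decode 0 i = 0"
  by (induction i) (simp_all add: int_seq_decode_0 int_seq_decode_Suc prod_decode_zero int_decode_zero)

lemma finite_support_int_seq_decode: "finite {i. int_seq_decode c i \<noteq> 0}"
proof (induction c rule: less_induct)
  case (less c)
  show ?case
  proof (cases "c = 0")
    case True
    then show ?thesis by (simp add: int_seq_decode_zero)
  next
    case False
    then have fin: "finite {i. int_seq_decode (fst (prod_decode c)) i \<noteq> 0}"
      using less fst_prod_decode_less by blast
    have "{i. int_seq_decode c i \<noteq> 0} \<subseteq>
        insert 0 (Suc ` {i. int_seq_decode (fst (prod_decode c)) i \<noteq> 0})"
    proof
      fix i assume "i \<in> {i. int_seq_decode c i \<noteq> 0}"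
      then show "i \<in> insert 0 (Suc ` {i. int_seq_decode (fst (prod_decode c)) i \<noteq> 0})"
        by (cases i) (auto simp: int_seq_decode_Suc)
    qed
    with fin show ?thesis by (meson finite.insertI finite_imageI finite_subset)
  qed
qed

lemma inj_int_seq_decode: "inj int_seq_decode"
proof (rule injI)
  fix c d assume "int_seq_decode c = int_seq_decode d"
  then show "c = d"
  proof (induction c arbitrary: d rule: less_induct)
    case (less c)
    have snd_eq: "snd (prod_decode c) = snd (prod_decode d)"
      using fun_cong[OF less.prems, of 0] by (simp add: int_seq_decode_0 int_decode_eq)
    have tl_eq: "int_seq_decode (fst (prod_decode c)) = int_seq_decode (fst (prod_decode d))"
    proof (rule HOL.ext)
      show "int_seq_decode (fst (prod_decode c)) i = int_seq_decode (fst (prod_decode d)) i" for i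
        using fun_cong[OF less.prems, of "Suc i"] by (simp only: int_seq_decode_Suc)
    qed
    show ?case
    proof (cases "c = 0")
      case False
      then have "fst (prod_decode c) = fst (prod_decode d)"
        using less.IH tl_eq fst_prod_decode_less by blast
      from prod_eqI[OF this snd_eq] have "prod_decode c = prod_decode d" .
      then show ?thesis by simp
    next
      case True
      have zero: "d = 0" if "int_seq_decode d = int_seq_decode 0" for d
        using that
      proof (induction d rule: less_induct)
        case (less d)
        show ?case
        proof (rule ccontr)
          assume "d \<noteq> 0"
          have "int_seq_decode (fst (prod_decode d)) = int_seq_decode 0"
          proof (rule HOL.ext)
            show "int_seq_decode (fst (prod_decode d)) i = int_seq_decode 0 i" for i
              using fun_cong[OF less.prems, of "Suc i"]
              by (simp only: int_seq_decode_Suc prod_decode_zero fst_conv)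
          qed
          then have "fst (prod_decode d) = 0"
            using less.IH fst_prod_decode_less \<open>d \<noteq> 0\<close> by blast
          moreover have "snd (prod_decode d) = 0"
            using fun_cong[OF less.prems, of 0]
            by (simp only: int_seq_decode_0 prod_decode_zero snd_conv int_decode_eq)
          ultimately have "prod_decode d = (0, 0)" by (rule prod_eqI[where q = "(0, 0)", simplified])
          then have "prod_decode d = prod_decode 0" by (simp only: prod_decode_zero)
          with \<open>d \<noteq> 0\<close> show False by simp
        qed
      qed
      have "int_seq_decode d = int_seq_decode 0"
        using less.prems unfolding True by (rule sym)
      then have "d = 0" by (rule zero)
      with True show ?thesis by simp
    qed
  qed
qed

lemma int_seq_decode_surj:
  assumes "\<And>i. i \<ge> n \<Longrightarrow> z i = 0"
  shows "\<exists>c. int_seq_decode c = z"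
  using assms
proof (induction n arbitrary: z)
  case 0
  then have "int_seq_decode 0 = z" by (auto simp: int_seq_decode_zero)
  then show ?case ..
next
  case (Suc n)
  from Suc.IH[of "\<lambda>i. z (Suc i)"] Suc.prems obtain b where
    b: "int_seq_decode b = (\<lambda>i. z (Suc i))" by auto
  have "int_seq_decode (prod_encode (b, int_encode (z 0))) i = z i" for i
    by (cases i) (auto simp: int_seq_decode_0 int_seq_decode_Suc b)
  then show ?case by blast
qed

lemma bij_betw_int_seq_decode: "bij_betw int_seq_decode UNIV (carrier int_direct_sum)"
proof -
  have carrier: "carrier int_direct_sum = {z. finite {i. z i \<noteq> 0}}"
    by (simp add: int_direct_sum_def carrier_sum_group)
  have "z \<in> range int_seq_decode" if "finite {i. z i \<noteq> 0}" for z
  proof -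
    from that obtain n where "\<forall>i \<in> {i. z i \<noteq> 0}. i < n"
      using finite_nat_set_iff_bounded by blast
    then have "\<exists>c. int_seq_decode c = z" by (intro int_seq_decode_surj[of n]) force
    then show ?thesis by blast
  qed
  then show ?thesis
    unfolding bij_betw_def carrier
    using inj_int_seq_decode finite_support_int_seq_decode by auto
qed

end

theory Submission
  imports Defs
begin

text \<open>
  Let \<open>n\<close> be the total function with index \<open>m\<close>.  It enumerates a Foelner sequence if and only if all
  \<open>n j\<close> are nonzero and, for all \<open>g\<close> and \<open>k\<close>, the inequality \<open>k |F - g F| \<le> |F|\<close> holds for all but finitely many
  of the sets \<open>F\<close> with canonical index \<open>n j\<close>.  In a computable group with decidable equality
  this inequality is decidable, so the condition has the form \<open>\<forall>\<exists>\<forall>\<close>.  Totality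
  is a \<open>\<forall>\<exists>\<close>-condition because the graph of a partial recursive function is recursively enumerable
  (\<open>partial_recursive_stagewise\<close>).  The two conditions are merged into one \<open>\<forall>\<exists>\<forall>\<close>-formula in
  \<open>folner_indices_in_pi_sets_3\<close>.

  For completeness let \<open>x \<in> A\<close> be given by \<open>\<forall>a. \<exists>b. \<forall>c. T [c, b, a, x]\<close>.  There is a recursive set of
  ``events'' for \<open>a\<close> that is finite if and only if \<open>\<exists>b. \<forall>c. T [c, b, a, x]\<close>
  (\<open>finite_refutation_event_iff\<close>).  Consider in the direct sum of copies of the integers the box with
  side length \<open>j + 1\<close> in each direction \<open>a < j\<close>, except that it has side length \<open>1\<close> in direction \<open>a\<close> if \<open>j\<close>
  is an event for \<open>a\<close>.  A box of side length \<open>L\<close> in direction \<open>a\<close> loses the fraction \<open>1 / L\<close> of its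
  elements under translation by the \<open>a\<close>-th generator.  If all sets of events are finite, all side
  lengths tend to infinity and the boxes form a Foelner sequence, since the Foelner condition
  has to be tested on generators only (\<open>folner_sequence_boxes\<close>).  If some set of events is infinite, then
  infinitely many boxes are disjoint from their translate by one fixed generator
  (\<open>not_folner_sequence_boxes\<close>).  The boxes are computable uniformly in \<open>x\<close>, so the s-m-n property
  yields the reduction.
\<close>

section \<open>Total recursive functions\<close>

text \<open>
  Recursiveness is proved below by resolution with one rule per operation.  A formula with several
  variables is read as a function of one list of arguments, the variables being its entries.  A rule for
  an operator that binds a variable (recursion, sums, bounded quantifiers, minimisation) pushes
  the bound variable onto the front of the list, so that the outer variables become entries of the
  tail; this is why the rules for projections also cover entries of iterated tails.
\<close>

definition total_recursive :: "nat \<Rightarrow> (nat list \<Rightarrow> nat) \<Rightarrow> bool" where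
  "total_recursive n f \<longleftrightarrow> partial_recursive n (\<lambda>xs. Some (f xs))"

named_theorems recursive_intros

lemma recursive_relation_iff:
  "recursive_relation n P \<longleftrightarrow> total_recursive n (\<lambda>xs. if P xs then 1 else 0)"
  by (simp add: recursive_relation_def total_recursive_def)

lemma total_recursive_cong:
  assumes "total_recursive n f" "\<And>xs. length xs = n \<Longrightarrow> g xs = f xs"
  shows "total_recursive n g"
  using assms unfolding total_recursive_def by (auto intro: partial_recursive.ext)

lemma recursive_relation_cong:
  assumes "recursive_relation n P" "\<And>xs. length xs = n \<Longrightarrow> Q xs \<longleftrightarrow> P xs"
  shows "recursive_relation n Q"
  using assms(1) unfolding recursive_relation_iff
  by (rule total_recursive_cong) (simp add: assms(2))

lemma total_recursive_nth [recursive_intros]: "i < n \<Longrightarrow> total_recursive n (\<lambda>xs. xs ! i)"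
  by (simp add: total_recursive_def partial_recursive.proj)

lemma those_map_Some: "those (map (\<lambda>g. Some (h g)) gs) = Some (map h gs)"
  by (induction gs) auto

lemma total_recursive_map:
  assumes "total_recursive (length gs) f" "\<And>g. g \<in> set gs \<Longrightarrow> total_recursive n g"
  shows "total_recursive n (\<lambda>xs. f (map (\<lambda>g. g xs) gs))"
proof -
  let ?gs = "map (\<lambda>g xs. Some (g xs)) gs"
  have "partial_recursive n (\<lambda>xs. Option.bind (those (map (\<lambda>g. g xs) ?gs)) (\<lambda>xs. Some (f xs)))"
    using assms by (intro partial_recursive.comp) (auto simp: total_recursive_def)
  then show ?thesis
    by (simp add: total_recursive_def o_def those_map_Some)
qed

text \<open>
  A change of variables from \<open>m\<close> to \<open>n\<close> arguments.  Such maps are needed whenever a recursive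
  function that is known only abstractly, such as the matrix of an arithmetical formula, is applied
  to arguments computed from those in the context.
\<close>

definition recursive_map :: "nat \<Rightarrow> nat \<Rightarrow> (nat list \<Rightarrow> nat list) \<Rightarrow> bool" where
  "recursive_map n m \<sigma> \<longleftrightarrow> (\<forall>i<m. total_recursive n (\<lambda>xs. \<sigma> xs ! i)) \<and>
     (\<forall>xs. length xs = n \<longrightarrow> length (\<sigma> xs) = m)"

lemma total_recursive_subst:
  assumes "total_recursive m f" "recursive_map n m \<sigma>"
  shows "total_recursive n (\<lambda>xs. f (\<sigma> xs))"
proof -
  have "total_recursive n (\<lambda>xs. f (map (\<lambda>g. g xs) (map (\<lambda>i xs. \<sigma> xs ! i) [0..<m])))"
    using assms by (intro total_recursive_map) (auto simp: recursive_map_def)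
  then show ?thesis
  proof (rule total_recursive_cong)
    fix xs :: "nat list" assume "length xs = n"
    then have "length (\<sigma> xs) = m" using assms by (simp add: recursive_map_def)
    then have "map (\<lambda>i. \<sigma> xs ! i) [0..<m] = \<sigma> xs" by (metis map_nth)
    then show "f (\<sigma> xs) = f (map (\<lambda>g. g xs) (map (\<lambda>i xs. \<sigma> xs ! i) [0..<m]))"
      by (simp add: o_def)
  qed
qed

lemma recursive_relation_subst:
  "recursive_relation m P \<Longrightarrow> recursive_map n m \<sigma> \<Longrightarrow> recursive_relation n (\<lambda>xs. P (\<sigma> xs))"
  unfolding recursive_relation_iff by (rule total_recursive_subst)

lemma length_funpow_tl: "length ((tl ^^ k) xs) = length xs - k"
  by (induction k) auto

lemma nth_funpow_tl: "k + i < length xs \<Longrightarrow> (tl ^^ k) xs ! i = xs ! (k + i)"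
  by (induction k arbitrary: i) (auto simp: nth_tl length_funpow_tl)

lemma recursive_map_funpow_tl:
  assumes "n = m + k"
  shows "recursive_map n m (\<lambda>xs. (tl ^^ k) xs)"
proof -
  have "total_recursive n (\<lambda>xs. (tl ^^ k) xs ! i)" if "i < m" for i
    using that assms
    by (intro total_recursive_cong[OF total_recursive_nth[of "k + i"]]) (auto simp: nth_funpow_tl)
  then show ?thesis using assms by (simp add: recursive_map_def length_funpow_tl)
qed

lemma total_recursive_nth_funpow_tl:
  "k + i < n \<Longrightarrow> total_recursive n (\<lambda>xs. (tl ^^ k) xs ! i)"
  using recursive_map_funpow_tl[of n "n - k" k] by (simp add: recursive_map_def)

lemmas total_recursive_nth_tl [recursive_intros] =
  total_recursive_nth_funpow_tl[of 1, simplified]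
  total_recursive_nth_funpow_tl[of 2, unfolded eval_nat_numeral, simplified]
  total_recursive_nth_funpow_tl[of 3, unfolded eval_nat_numeral, simplified]
  total_recursive_nth_funpow_tl[of "Suc (Suc (Suc (Suc 0)))", simplified]
  total_recursive_nth_funpow_tl[of "Suc (Suc (Suc (Suc (Suc 0))))", simplified]

lemmas recursive_map_tl [recursive_intros] =
  recursive_map_funpow_tl[of _ _ 0, simplified]
  recursive_map_funpow_tl[of _ _ 1, simplified]
  recursive_map_funpow_tl[of _ _ 2, unfolded eval_nat_numeral, simplified]
  recursive_map_funpow_tl[of _ _ 3, unfolded eval_nat_numeral, simplified]
  recursive_map_funpow_tl[of _ _ "Suc (Suc (Suc (Suc 0)))", simplified]

lemma recursive_map_Nil [recursive_intros]: "recursive_map n 0 (\<lambda>xs. [])"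
  by (simp add: recursive_map_def)

lemma recursive_map_Cons [recursive_intros]:
  assumes "total_recursive n f" "recursive_map n m \<sigma>"
  shows "recursive_map n (Suc m) (\<lambda>xs. f xs # \<sigma> xs)"
  using assms unfolding recursive_map_def by (auto simp: less_Suc_eq_0_disj)

lemma total_recursive_compose1:
  assumes "total_recursive 1 (\<lambda>xs. h (xs ! 0))" "total_recursive n f"
  shows "total_recursive n (\<lambda>xs. h (f xs))"
proof -
  have "recursive_map n 1 (\<lambda>xs. [f xs])"
    using recursive_map_Cons[OF assms(2) recursive_map_Nil] by simp
  from total_recursive_subst[OF assms(1) this] show ?thesis by simp
qed

lemma total_recursive_compose2:
  assumes "total_recursive 2 (\<lambda>xs. h (xs ! 0) (xs ! 1))" "total_recursive n f" "total_recursive n g"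
  shows "total_recursive n (\<lambda>xs. h (f xs) (g xs))"
proof -
  have "recursive_map n 2 (\<lambda>xs. [f xs, g xs])"
    using recursive_map_Cons[OF assms(2) recursive_map_Cons[OF assms(3) recursive_map_Nil]]
    by (simp add: numeral_2_eq_2)
  from total_recursive_subst[OF assms(1) this] show ?thesis by simp
qed

lemma total_recursive_Suc [recursive_intros]:
  assumes "total_recursive n f"
  shows "total_recursive n (\<lambda>xs. Suc (f xs))"
proof -
  have "partial_recursive 1 (\<lambda>xs. Some (Suc (xs ! 0)))"
    using partial_recursive.succ
  proof (rule partial_recursive.ext)
    fix xs :: "nat list" assume "length xs = 1"
    then show "Some (Suc (xs ! 0)) = Some (Suc (hd xs))" by (cases xs) auto
  qed
  then have "total_recursive 1 (\<lambda>xs. Suc (xs ! 0))" by (simp add: total_recursive_def)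
  then show ?thesis using assms by (rule total_recursive_compose1)
qed

lemma total_recursive_const [recursive_intros]: "total_recursive n (\<lambda>xs. c)"
proof (induction c)
  case 0
  then show ?case by (simp add: total_recursive_def partial_recursive.zero)
qed (rule total_recursive_Suc)

text \<open>
  The primitive recursion scheme recurses on the first argument.  Substituting the recursion depth
  for that argument yields recursion up to an arbitrary recursive bound.
\<close>

lemma total_recursive_rec_nat [recursive_intros]:
  assumes b: "total_recursive n b"
    and h: "total_recursive (Suc (Suc n)) (\<lambda>ys. h (ys ! 0) (ys ! 1) (tl (tl ys)))"
    and k: "total_recursive n k"
  shows "total_recursive n (\<lambda>xs. rec_nat (b xs) (\<lambda>j r. h j r xs) (k xs))"
proof -
  let ?h = "\<lambda>ys. h (ys ! 0) (ys ! 1) (tl (tl ys))"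
  have "partial_recursive (Suc n)
      (\<lambda>xs. prim_rec (\<lambda>xs. Some (b xs)) (\<lambda>ys. Some (?h ys)) (hd xs) (tl xs))"
    using b h by (intro partial_recursive.prim) (simp_all add: total_recursive_def)
  moreover have "prim_rec (\<lambda>xs. Some (b xs)) (\<lambda>ys. Some (?h ys)) j xs =
      Some (rec_nat (b xs) (\<lambda>j r. h j r xs) j)" for j xs
    by (induction j) (simp_all add: prim_rec_def)
  ultimately have "total_recursive (Suc n)
      (\<lambda>xs. rec_nat (b (tl xs)) (\<lambda>j r. h j r (tl xs)) (hd xs))"
    by (simp add: total_recursive_def)
  from total_recursive_subst[OF this, of n "\<lambda>xs. k xs # xs"] show ?thesis
    using k by (simp add: recursive_map_Cons recursive_map_tl)
qed

subsection \<open>Arithmetic\<close>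

lemma total_recursive_add [recursive_intros]:
  assumes "total_recursive n f" "total_recursive n g"
  shows "total_recursive n (\<lambda>xs. f xs + g xs)"
proof -
  have "rec_nat x (\<lambda>_ r. Suc r) y = x + y" for x y
    by (induction y) auto
  moreover have "total_recursive n (\<lambda>xs. rec_nat (f xs) (\<lambda>_ r. Suc r) (g xs))"
    by (intro recursive_intros assms) auto
  ultimately show ?thesis by simp
qed

lemma total_recursive_mult [recursive_intros]:
  assumes "total_recursive n f" "total_recursive n g"
  shows "total_recursive n (\<lambda>xs. f xs * g xs)"
proof (rule total_recursive_compose2[OF _ assms])
  have "rec_nat 0 (\<lambda>_ r. x + r) y = x * y" for x y :: nat
    by (induction y) auto
  moreover have "total_recursive 2 (\<lambda>xs. rec_nat 0 (\<lambda>_ r. xs ! 0 + r) (xs ! 1))"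
    by (intro recursive_intros) auto
  ultimately show "total_recursive 2 (\<lambda>xs. xs ! 0 * xs ! 1)" by simp
qed

lemma total_recursive_power [recursive_intros]:
  assumes "total_recursive n f" "total_recursive n g"
  shows "total_recursive n (\<lambda>xs. f xs ^ g xs)"
proof (rule total_recursive_compose2[OF _ assms])
  have "rec_nat 1 (\<lambda>_ r. x * r) y = x ^ y" for x y :: nat
    by (induction y) auto
  moreover have "total_recursive 2 (\<lambda>xs. rec_nat 1 (\<lambda>_ r. xs ! 0 * r) (xs ! 1))"
    by (intro recursive_intros) auto
  ultimately show "total_recursive 2 (\<lambda>xs. xs ! 0 ^ xs ! 1)" by simp
qed

lemma total_recursive_diff [recursive_intros]:
  assumes "total_recursive n f" "total_recursive n g"
  shows "total_recursive n (\<lambda>xs. f xs - g xs)"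
proof -
  have "rec_nat 0 (\<lambda>j _. j) y = y - 1" for y
    by (cases y) auto
  moreover have "total_recursive 1 (\<lambda>xs. rec_nat 0 (\<lambda>j _. j) (xs ! 0))"
    by (intro recursive_intros) auto
  ultimately have pred: "total_recursive 1 (\<lambda>xs. xs ! 0 - 1)" by simp
  have "rec_nat x (\<lambda>_ r. r - 1) y = x - y" for x y :: nat
    by (induction y) auto
  moreover have "total_recursive n (\<lambda>xs. rec_nat (f xs) (\<lambda>_ r. r - 1) (g xs))"
    by (intro recursive_intros assms total_recursive_compose1[OF pred]) auto
  ultimately show ?thesis by simp
qed

lemma total_recursive_if [recursive_intros]:
  assumes "recursive_relation n P" "total_recursive n f" "total_recursive n g"
  shows "total_recursive n (\<lambda>xs. if P xs then f xs else g xs)"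
proof -
  have "total_recursive n (\<lambda>xs. (if P xs then 1 else 0) * f xs + (1 - (if P xs then 1 else 0)) * g xs)"
    using assms by (intro total_recursive_add total_recursive_mult total_recursive_diff
        total_recursive_const) (simp_all add: recursive_relation_iff)
  then show ?thesis by (rule total_recursive_cong) simp
qed

lemma recursive_relation_not [recursive_intros]:
  assumes "recursive_relation n P"
  shows "recursive_relation n (\<lambda>xs. \<not> P xs)"
proof -
  have "total_recursive n (\<lambda>xs. if P xs then 0 else 1)"
    by (intro recursive_intros assms)
  then show ?thesis
    unfolding recursive_relation_iff by (rule total_recursive_cong) simp
qed

lemma recursive_relation_conj [recursive_intros]:
  assumes "recursive_relation n P" "recursive_relation n Q"
  shows "recursive_relation n (\<lambda>xs. P xs \<and> Q xs)"
proof -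
  have "total_recursive n (\<lambda>xs. if P xs then if Q xs then 1 else 0 else 0)"
    by (intro recursive_intros assms)
  then show ?thesis
    unfolding recursive_relation_iff by (rule total_recursive_cong) simp
qed

lemma recursive_relation_imp [recursive_intros]:
  assumes "recursive_relation n P" "recursive_relation n Q"
  shows "recursive_relation n (\<lambda>xs. P xs \<longrightarrow> Q xs)"
  by (rule recursive_relation_cong[OF recursive_relation_not[OF recursive_relation_conj[OF assms(1)
    recursive_relation_not[OF assms(2)]]]]) simp

lemma recursive_relation_le [recursive_intros]:
  assumes "total_recursive n f" "total_recursive n g"
  shows "recursive_relation n (\<lambda>xs. f xs \<le> g xs)"
proof -
  have "total_recursive n (\<lambda>xs. 1 - (f xs - g xs))"
    by (intro recursive_intros assms)
  then show ?thesis
    unfolding recursive_relation_iff by (rule total_recursive_cong) simp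
qed

lemma recursive_relation_less [recursive_intros]:
  assumes "total_recursive n f" "total_recursive n g"
  shows "recursive_relation n (\<lambda>xs. f xs < g xs)"
  using recursive_relation_not[OF recursive_relation_le[OF assms(2,1)]] by (simp add: not_le)

lemma recursive_relation_eq [recursive_intros]:
  assumes "total_recursive n f" "total_recursive n g"
  shows "recursive_relation n (\<lambda>xs. f xs = g xs)"
  by (rule recursive_relation_cong[OF recursive_relation_conj[OF
    recursive_relation_le[OF assms] recursive_relation_le[OF assms(2,1)]]]) auto

lemma total_recursive_sum [recursive_intros]:
  assumes "total_recursive n b" "total_recursive (Suc n) (\<lambda>ys. h (ys ! 0) (tl ys))"
  shows "total_recursive n (\<lambda>xs. \<Sum>i<b xs. h i xs)"
proof -
  have "rec_nat 0 (\<lambda>j r. r + h j xs) k = (\<Sum>i<k. h i xs)" for k xs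
    by (induction k) auto
  moreover have "recursive_map (Suc (Suc n)) (Suc n) (\<lambda>ys. ys ! 0 # tl (tl ys))"
    by (intro recursive_intros) auto
  from total_recursive_subst[OF assms(2) this]
  have "total_recursive n (\<lambda>xs. rec_nat 0 (\<lambda>j r. r + h j xs) (b xs))"
    by (intro recursive_intros assms) auto
  ultimately show ?thesis by simp
qed

lemma recursive_relation_all_less [recursive_intros]:
  assumes "total_recursive n b" "recursive_relation (Suc n) (\<lambda>ys. P (ys ! 0) (tl ys))"
  shows "recursive_relation n (\<lambda>xs. \<forall>i<b xs. P i xs)"
proof -
  have "recursive_relation n (\<lambda>xs. (\<Sum>i<b xs. if P i xs then 0 else 1) = (0 :: nat))"
    by (intro recursive_intros assms)
  then show ?thesis
    by (rule recursive_relation_cong) auto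
qed

lemma recursive_relation_ex_less [recursive_intros]:
  assumes "total_recursive n b" "recursive_relation (Suc n) (\<lambda>ys. P (ys ! 0) (tl ys))"
  shows "recursive_relation n (\<lambda>xs. \<exists>i<b xs. P i xs)"
proof -
  have "recursive_relation n (\<lambda>xs. \<not> (\<forall>i<b xs. \<not> P i xs))"
    by (intro recursive_intros assms)
  then show ?thesis by simp
qed

text \<open>
  The hypothesis that a solution always exists makes the unbounded search total; no bound on the
  solution has to be computed.
\<close>

lemma total_recursive_Least [recursive_intros]:
  assumes P: "recursive_relation (Suc n) (\<lambda>ys. P (ys ! 0) (tl ys))"
    and ex: "\<And>xs. length xs = n \<Longrightarrow> \<exists>k. P k xs"
  shows "total_recursive n (\<lambda>xs. LEAST k. P k xs)"
proof -
  let ?f = "\<lambda>ys. if P (ys ! 0) (tl ys) then 0 else 1 :: nat"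
  have "partial_recursive (Suc n) (\<lambda>ys. Some (?f ys))"
    using total_recursive_if[OF P total_recursive_const total_recursive_const]
    by (simp add: total_recursive_def)
  then have "partial_recursive n (mu_search (\<lambda>ys. Some (?f ys)))"
    by (rule partial_recursive.mu)
  then show ?thesis
    unfolding total_recursive_def
  proof (rule partial_recursive.ext)
    fix xs :: "nat list" assume "length xs = n"
    with ex have "P (LEAST k. P k xs) xs" by (metis LeastI_ex)
    moreover have "\<forall>j < (LEAST k. P k xs). \<not> P j xs" using not_less_Least by blast
    ultimately have "\<exists>k. P k xs \<and> (\<forall>j<k. \<not> P j xs)" by blast
    then show "Some (LEAST k. P k xs) = mu_search (\<lambda>ys. Some (?f ys)) xs"
      by (auto simp: mu_search_def)
  qed
qed

lemma recursive_relation_even [recursive_intros]: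
  assumes "total_recursive n f"
  shows "recursive_relation n (\<lambda>xs. even (f xs))"
proof -
  have "even x \<longleftrightarrow> (\<exists>y<Suc x. x = 2 * y)" for x :: nat
    by (auto elim: evenE)
  moreover have "recursive_relation 1 (\<lambda>xs. \<exists>y<Suc (xs ! 0). xs ! 0 = 2 * y)"
    by (intro recursive_intros) auto
  ultimately have "total_recursive 1 (\<lambda>xs. if even (xs ! 0) then 1 else 0)"
    by (simp add: recursive_relation_iff)
  then show ?thesis
    unfolding recursive_relation_iff
    using assms by (rule total_recursive_compose1[where h = "\<lambda>x. if even x then 1 else 0"])
qed

lemma recursive_relation_disj [recursive_intros]:
  assumes "recursive_relation n P" "recursive_relation n Q"
  shows "recursive_relation n (\<lambda>xs. P xs \<or> Q xs)"
  by (rule recursive_relation_cong[OF recursive_relation_imp[OF recursive_relation_not[OF assms(1)]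
    assms(2)]]) blast

lemma recursive_relation_all_le [recursive_intros]:
  assumes "total_recursive n b" "recursive_relation (Suc n) (\<lambda>ys. P (ys ! 0) (tl ys))"
  shows "recursive_relation n (\<lambda>xs. \<forall>i\<le>b xs. P i xs)"
  using recursive_relation_all_less[OF total_recursive_Suc[OF assms(1)] assms(2)]
  by (simp add: less_Suc_eq_le)

lemma recursive_relation_ex_le [recursive_intros]:
  assumes "total_recursive n b" "recursive_relation (Suc n) (\<lambda>ys. P (ys ! 0) (tl ys))"
  shows "recursive_relation n (\<lambda>xs. \<exists>i\<le>b xs. P i xs)"
  using recursive_relation_ex_less[OF total_recursive_Suc[OF assms(1)] assms(2)]
  by (simp add: less_Suc_eq_le)

text \<open>
  Division is the search for the first \<open>q\<close> with \<open>x < (q + 1) y\<close>.  For \<open>y = 0\<close> there is no such \<open>q\<close>; the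
  additional disjunct \<open>y = 0\<close> keeps the search total there, and its result is discarded.
\<close>

lemma total_recursive_div [recursive_intros]:
  assumes "total_recursive n f" "total_recursive n g"
  shows "total_recursive n (\<lambda>xs. f xs div g xs)"
proof (rule total_recursive_compose2[OF _ assms])
  have "(if y = 0 then 0 else LEAST q. x < Suc q * y \<or> y = 0) = x div y" for x y :: nat
  proof (cases "y = 0")
    case False
    have "(LEAST q. x < Suc q * y \<or> y = 0) = x div y"
    proof (rule Least_equality)
      show "x < Suc (x div y) * y \<or> y = 0"
        using False dividend_less_div_times[of y x] by (simp add: add.commute)
      show "x div y \<le> q" if "x < Suc q * y \<or> y = 0" for q
        using that False by (simp add: less_mult_imp_div_less less_Suc_eq_le[symmetric] del: mult_Suc)
    qed
    with False show ?thesis by simp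
  qed simp
  moreover have "total_recursive 2 (\<lambda>xs. if xs ! 1 = 0 then 0
      else LEAST q. xs ! 0 < Suc q * xs ! 1 \<or> xs ! 1 = 0)"
  proof (intro recursive_intros)
    show "\<exists>q. xs ! 0 < Suc q * xs ! 1 \<or> xs ! 1 = 0" for xs :: "nat list"
      by (metis dividend_less_div_times add.commute mult_Suc neq0_conv)
  qed auto
  ultimately show "total_recursive 2 (\<lambda>xs. xs ! 0 div xs ! 1)" by (simp only:)
qed

subsection \<open>Codes of pairs, finite sets and integer sequences\<close>

lemma computable1_iff: "computable1 h \<longleftrightarrow> total_recursive 1 (\<lambda>xs. h (xs ! 0))"
  by (simp add: computable1_def partial_recursive1_def total_recursive_def)

lemma computable2_iff: "computable2 h \<longleftrightarrow> total_recursive 2 (\<lambda>xs. h (xs ! 0) (xs ! 1))"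
  by (simp add: computable2_def partial_recursive2_def total_recursive_def)

lemma total_recursive_prod_encode [recursive_intros]:
  assumes "total_recursive n f" "total_recursive n g"
  shows "total_recursive n (\<lambda>xs. prod_encode (f xs, g xs))"
  unfolding prod_encode_def triangle_def prod.case by (intro recursive_intros assms)

lemma total_recursive_fst_prod_decode [recursive_intros]:
  assumes "total_recursive n f"
  shows "total_recursive n (\<lambda>xs. fst (prod_decode (f xs)))"
proof (rule total_recursive_compose1[OF _ assms])
  have ex: "\<exists>b\<le>c. prod_encode (fst (prod_decode c), b) = c" for c
    by (metis le_prod_encode_2 prod.collapse prod_decode_inverse)
  have "(LEAST a. \<exists>b\<le>c. prod_encode (a, b) = c) = fst (prod_decode c)" for c
    using ex by (intro Least_equality) auto
  moreover have "total_recursive 1 (\<lambda>xs. LEAST a. \<exists>b\<le>xs ! 0. prod_encode (a, b) = xs ! 0)"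
  proof (intro recursive_intros)
    show "\<exists>a. \<exists>b\<le>xs ! 0. prod_encode (a, b) = xs ! 0" for xs :: "nat list"
      using ex by blast
  qed auto
  ultimately show "total_recursive 1 (\<lambda>xs. fst (prod_decode (xs ! 0)))" by simp
qed

lemma total_recursive_snd_prod_decode [recursive_intros]:
  assumes "total_recursive n f"
  shows "total_recursive n (\<lambda>xs. snd (prod_decode (f xs)))"
proof (rule total_recursive_compose1[OF _ assms])
  have ex: "prod_encode (fst (prod_decode c), snd (prod_decode c)) = c" for c
    by simp
  have "(LEAST b. prod_encode (fst (prod_decode c), b) = c) = snd (prod_decode c)" for c
  proof (rule Least_equality)
    show "snd (prod_decode c) \<le> b" if "prod_encode (fst (prod_decode c), b) = c" for b
      using arg_cong[OF that, of prod_decode] by (cases "prod_decode c") simp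
  qed (rule ex)
  moreover have "total_recursive 1 (\<lambda>xs. LEAST b. prod_encode (fst (prod_decode (xs ! 0)), b) = xs ! 0)"
  proof (intro recursive_intros)
    show "\<exists>b. prod_encode (fst (prod_decode (xs ! 0)), b) = xs ! 0" for xs :: "nat list"
      using ex by blast
  qed auto
  ultimately show "total_recursive 1 (\<lambda>xs. snd (prod_decode (xs ! 0)))" by simp
qed

lemma recursive_relation_mem_set_decode [recursive_intros]:
  assumes "total_recursive n f" "total_recursive n g"
  shows "recursive_relation n (\<lambda>xs. f xs \<in> set_decode (g xs))"
  unfolding set_decode_def mem_Collect_eq by (intro recursive_intros assms)

lemma set_decode_subset: "set_decode n \<subseteq> {..<n}"
proof
  fix x assume "x \<in> set_decode n"
  then have "n div 2 ^ x \<noteq> 0" by (metis even_zero mem_Collect_eq set_decode_def)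
  then have "2 ^ x \<le> n" by (metis div_less linorder_not_le)
  then show "x \<in> {..<n}" by (metis lessThan_iff less_exp order_less_le_trans)
qed

lemma card_set_decode_Collect:
  "card {x \<in> set_decode n. P x} = (\<Sum>x<n. if x \<in> set_decode n \<and> P x then 1 else 0)"
proof -
  have "{x \<in> set_decode n. P x} = {..<n} \<inter> {x. x \<in> set_decode n \<and> P x}"
    using set_decode_subset[of n] by auto
  then show ?thesis by (simp add: sum.If_cases)
qed

lemma total_recursive_card_set_decode [recursive_intros]:
  assumes "total_recursive n f"
  shows "total_recursive n (\<lambda>xs. card (set_decode (f xs)))"
proof (rule total_recursive_compose1[OF _ assms])
  have "total_recursive 1 (\<lambda>xs. \<Sum>x<xs ! 0. if x \<in> set_decode (xs ! 0) then 1 else 0)"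
    by (intro recursive_intros) auto
  then show "total_recursive 1 (\<lambda>xs. card (set_decode (xs ! 0)))"
    using card_set_decode_Collect[of _ "\<lambda>_. True"] by simp
qed

text \<open>
  The code of the integer at position \<open>i\<close> of the sequence coded by \<open>c\<close>; working with this code
  avoids integer arithmetic in recursive definitions.
\<close>

definition entry_code :: "nat \<Rightarrow> nat \<Rightarrow> nat" where
  "entry_code c i = snd (prod_decode (((\<lambda>b. fst (prod_decode b)) ^^ i) c))"

lemma int_seq_decode_entry_code: "int_seq_decode c i = int_decode (entry_code c i)"
  by (simp add: int_seq_decode_def entry_code_def)

lemma total_recursive_entry_code [recursive_intros]:
  assumes "total_recursive n f" "total_recursive n g"
  shows "total_recursive n (\<lambda>xs. entry_code (f xs) (g xs))"
proof (rule total_recursive_compose2[OF _ assms])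
  have "((\<lambda>b. fst (prod_decode b)) ^^ i) c = rec_nat c (\<lambda>_ b. fst (prod_decode b)) i" for c i
    by (induction i) auto
  moreover have "total_recursive 2 (\<lambda>xs. snd (prod_decode
      (rec_nat (xs ! 0) (\<lambda>_ b. fst (prod_decode b)) (xs ! 1))))"
    by (intro recursive_intros) auto
  ultimately show "total_recursive 2 (\<lambda>xs. entry_code (xs ! 0) (xs ! 1))"
    by (simp add: entry_code_def)
qed

section \<open>Approximation of partial recursive functions in stages\<close>

text \<open>
  The graph of a partial recursive function is recursively enumerable.  This is expressed by a total
  recursive \<open>F\<close>, where \<open>F (t # xs) = 0\<close> means that the computation on \<open>xs\<close> has not halted
  by stage \<open>t\<close>, and \<open>F (t # xs) = Suc v\<close> that it has halted with result \<open>v\<close>.  Monotonicity in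
  the stage lets several computations be run to a common stage, which is what makes an induction over
  the formation rules of partial recursive functions possible without any coding of programs.
\<close>

definition stagewise :: "nat \<Rightarrow> (nat list \<Rightarrow> nat) \<Rightarrow> (nat list \<rightharpoonup> nat) \<Rightarrow> bool" where
  "stagewise n F f \<longleftrightarrow> total_recursive (Suc n) F \<and>
     (\<forall>xs. length xs = n \<longrightarrow>
        (\<forall>t t' v. t \<le> t' \<longrightarrow> F (t # xs) = Suc v \<longrightarrow> F (t' # xs) = Suc v) \<and>
        (\<forall>v. f xs = Some v \<longleftrightarrow> (\<exists>t. F (t # xs) = Suc v)))"

lemma stagewise_mono:
  "stagewise n F f \<Longrightarrow> length xs = n \<Longrightarrow> F (t # xs) = Suc v \<Longrightarrow> t \<le> t' \<Longrightarrow> F (t' # xs) = Suc v"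
  unfolding stagewise_def by blast

lemma stagewise_iff:
  "stagewise n F f \<Longrightarrow> length xs = n \<Longrightarrow> f xs = Some v \<longleftrightarrow> (\<exists>t. F (t # xs) = Suc v)"
  unfolding stagewise_def by blast

lemma stagewise_total_recursive: "stagewise n F f \<Longrightarrow> total_recursive (Suc n) F"
  unfolding stagewise_def by blast

lemma stagewiseI:
  assumes "total_recursive (Suc n) F"
    and "\<And>xs t t' v. length xs = n \<Longrightarrow> t \<le> t' \<Longrightarrow> F (t # xs) = Suc v \<Longrightarrow> F (t' # xs) = Suc v"
    and "\<And>xs v. length xs = n \<Longrightarrow> f xs = Some v \<longleftrightarrow> (\<exists>t. F (t # xs) = Suc v)"
  shows "stagewise n F f"
  using assms unfolding stagewise_def by blast

lemma finite_common_stage: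
  fixes P :: "'i \<Rightarrow> nat \<Rightarrow> bool"
  assumes "finite A" "\<And>a. a \<in> A \<Longrightarrow> \<exists>t. P a t"
    and "\<And>a t t'. a \<in> A \<Longrightarrow> P a t \<Longrightarrow> t \<le> t' \<Longrightarrow> P a t'"
  shows "\<exists>t. \<forall>a\<in>A. P a t"
  using assms
proof (induction A rule: finite_induct)
  case (insert a A)
  then obtain t where t: "\<forall>b\<in>A. P b t" by (metis insertCI)
  obtain s where "P a s" using insert.prems(1) by blast
  with t insert.prems(2) have "\<forall>b\<in>insert a A. P b (max s t)"
    by (metis insert_iff max.cobounded1 max.cobounded2)
  then show ?case ..
qed simp

lemma stagewise_of_total:
  assumes "total_recursive n f"
  shows "stagewise n (\<lambda>ys. Suc (f (tl ys))) (\<lambda>xs. Some (f xs))"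
proof (rule stagewiseI)
  show "total_recursive (Suc n) (\<lambda>ys. Suc (f (tl ys)))"
    by (intro recursive_intros total_recursive_subst[OF assms]) auto
qed auto

lemma recursive_relation_all_list [recursive_intros]:
  assumes "\<And>g. g \<in> set gs \<Longrightarrow> recursive_relation n (\<lambda>xs. P g xs)"
  shows "recursive_relation n (\<lambda>xs. \<forall>g\<in>set gs. P g xs)"
  using assms
proof (induction gs)
  case Nil
  have "recursive_relation n (\<lambda>xs. 0 = (0 :: nat))" by (intro recursive_intros)
  then show ?case by simp
next
  case (Cons g gs)
  then have "recursive_relation n (\<lambda>xs. P g xs \<and> (\<forall>g\<in>set gs. P g xs))"
    by (intro recursive_relation_conj) auto
  then show ?case by simp
qed

lemma those_eq_Some_iff: "those os = Some ys \<longleftrightarrow> os = map Some ys"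
proof (induction os arbitrary: ys)
  case (Cons a os)
  then show ?case by (cases a; cases ys) auto
qed auto

text \<open>
  The composition has halted by stage \<open>t\<close> once all inner functions have, and the outer one has on
  their results.  Conversely, the finitely many halting stages have a common upper bound.
\<close>

lemma stagewise_comp:
  assumes F: "stagewise (length gs) F f"
    and G: "\<And>g. g \<in> set gs \<Longrightarrow> stagewise n (G g) g"
  shows "stagewise n
    (\<lambda>ys. if \<forall>g\<in>set gs. 0 < G g ys then F (ys ! 0 # map (\<lambda>g. G g ys - 1) gs) else 0)
    (\<lambda>xs. Option.bind (those (map (\<lambda>g. g xs) gs)) f)" (is "stagewise n ?H _")
proof (rule stagewiseI)
  have G_rec: "total_recursive (Suc n) (G g)" if "g \<in> set gs" for g
    using G[OF that] by (rule stagewise_total_recursive)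
  have "total_recursive (Suc n) (\<lambda>ys. F (map (\<lambda>h. h ys) ((\<lambda>ys. ys ! 0) # map (\<lambda>g ys. G g ys - 1) gs)))"
    using stagewise_total_recursive[OF F] G_rec
    by (intro total_recursive_map) (auto intro: recursive_intros)
  then have "total_recursive (Suc n) (\<lambda>ys. F (ys ! 0 # map (\<lambda>g. G g ys - 1) gs))"
    by (simp add: o_def)
  then show "total_recursive (Suc n) ?H"
    by (intro recursive_intros G_rec)
next
  fix xs t t' v assume xs: "length xs = n" and "t \<le> t'" and H: "?H (t # xs) = Suc v"
  then have pos: "\<forall>g\<in>set gs. 0 < G g (t # xs)" by (auto split: if_splits)
  have same: "G g (t' # xs) = G g (t # xs)" if "g \<in> set gs" for g
  proof -
    obtain u where u: "G g (t # xs) = Suc u" using pos \<open>g \<in> set gs\<close> by (auto simp: gr0_conv_Suc)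
    with stagewise_mono[OF G[OF that] xs u \<open>t \<le> t'\<close>] show ?thesis by simp
  qed
  let ?us = "map (\<lambda>g. G g (t # xs) - 1) gs"
  have us: "map (\<lambda>g. G g (t' # xs) - 1) gs = ?us" using same by simp
  have "F (t # ?us) = Suc v" using H pos by simp
  from stagewise_mono[OF F _ this \<open>t \<le> t'\<close>] have "F (t' # ?us) = Suc v" by simp
  moreover have "\<forall>g\<in>set gs. 0 < G g (t' # xs)" using pos same by simp
  ultimately show "?H (t' # xs) = Suc v" unfolding us by simp
next
  fix xs :: "nat list" and v assume xs: "length xs = n"
  have "Option.bind (those (map (\<lambda>g. g xs) gs)) f = Some v \<longleftrightarrow>
      (\<exists>us. map (\<lambda>g. g xs) gs = map Some us \<and> f us = Some v)"
    by (auto simp: bind_eq_Some_conv those_eq_Some_iff)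
  also have "\<dots> \<longleftrightarrow> (\<exists>t. ?H (t # xs) = Suc v)"
  proof
    assume "\<exists>us. map (\<lambda>g. g xs) gs = map Some us \<and> f us = Some v"
    then obtain us where us: "map (\<lambda>g. g xs) gs = map Some us" and f: "f us = Some v" by blast
    from us have len: "length us = length gs" by (metis length_map)
    have us': "us = map (\<lambda>g. the (g xs)) gs"
      using arg_cong[OF us, of "map the"] by (simp add: o_def)
    have val: "g xs = Some (the (g xs))" if "g \<in> set gs" for g
    proof -
      from that have "g xs \<in> set (map Some us)" unfolding us[symmetric] by simp
      then show ?thesis by auto
    qed
    have "\<exists>t. \<forall>g\<in>set gs. G g (t # xs) = Suc (the (g xs))"
    proof (rule finite_common_stage)
      show "\<exists>t. G g (t # xs) = Suc (the (g xs))" if "g \<in> set gs" for g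
        using val[OF that] stagewise_iff[OF G[OF that] xs] by blast
      show "G g (t' # xs) = Suc (the (g xs))"
        if "g \<in> set gs" "G g (t # xs) = Suc (the (g xs))" "t \<le> t'" for g t t'
        using stagewise_mono[OF G[OF that(1)] xs that(2,3)] .
    qed simp
    then obtain t where t: "\<And>g. g \<in> set gs \<Longrightarrow> G g (t # xs) = Suc (the (g xs))" by blast
    obtain s where s: "F (s # us) = Suc v" using stagewise_iff[OF F len] f by blast
    have "G g (max s t # xs) = Suc (the (g xs))" if "g \<in> set gs" for g
      using stagewise_mono[OF G[OF that] xs t[OF that]] by simp
    moreover have "F (max s t # us) = Suc v" using stagewise_mono[OF F len s] by simp
    moreover have "map (\<lambda>g. G g (max s t # xs) - 1) gs = us"
      unfolding us' using calculation(1) by simp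
    ultimately have "?H (max s t # xs) = Suc v" by simp
    then show "\<exists>t. ?H (t # xs) = Suc v" ..
  next
    assume "\<exists>t. ?H (t # xs) = Suc v"
    then obtain t where t: "?H (t # xs) = Suc v" ..
    then have pos: "\<forall>g\<in>set gs. 0 < G g (t # xs)" by (auto split: if_splits)
    let ?us = "map (\<lambda>g. G g (t # xs) - 1) gs"
    have "g xs = Some (G g (t # xs) - 1)" if "g \<in> set gs" for g
      using stagewise_iff[OF G[OF that] xs, of "G g (t # xs) - 1"] pos that by force
    then have "map (\<lambda>g. g xs) gs = map Some ?us" by simp
    moreover have "f ?us = Some v" using stagewise_iff[OF F, of ?us v] t pos by force
    ultimately show "\<exists>us. map (\<lambda>g. g xs) gs = map Some us \<and> f us = Some v" by blast
  qed
  finally show "Option.bind (those (map (\<lambda>g. g xs) gs)) f = Some v \<longleftrightarrow> (\<exists>t. ?H (t # xs) = Suc v)" .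
qed

text \<open>
  The recursion is run with every call restricted to the same stage \<open>t\<close>; the value \<open>0\<close>, meaning
  that a call has not halted, is propagated.
\<close>

lemma stagewise_prim:
  assumes F: "stagewise n F f" and G: "stagewise (Suc (Suc n)) G g"
  shows "stagewise (Suc n)
    (\<lambda>ys. rec_nat (F (ys ! 0 # tl (tl ys)))
       (\<lambda>j r. if r = 0 then 0 else G (ys ! 0 # j # (r - 1) # tl (tl ys))) (ys ! 1))
    (\<lambda>xs. prim_rec f g (hd xs) (tl xs))" (is "stagewise _ ?H _")
proof (rule stagewiseI)
  have F': "total_recursive (Suc n) F" and G': "total_recursive (Suc (Suc (Suc n))) G"
    using F G by (simp_all add: stagewise_total_recursive)
  show "total_recursive (Suc (Suc n)) ?H"
    by (intro recursive_intros total_recursive_subst[OF F'] total_recursive_subst[OF G']) auto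
next
  define R where "R t zs = rec_nat (F (t # zs)) (\<lambda>j r. if r = 0 then 0 else G (t # j # (r - 1) # zs))"
    for t zs
  have H: "?H (t # k # zs) = R t zs k" for t k zs
    unfolding R_def nth_Cons_0 One_nat_def nth_Cons_Suc list.sel ..
  have R_Suc: "R t zs (Suc k) = Suc v \<longleftrightarrow> (\<exists>u. R t zs k = Suc u \<and> G (t # k # u # zs) = Suc v)" for t zs k v
  proof -
    have "R t zs (Suc k) = (if R t zs k = 0 then 0 else G (t # k # (R t zs k - 1) # zs))"
      by (simp only: R_def old.nat.simps)
    then show ?thesis by (cases "R t zs k") simp_all
  qed
  have mono: "R t' zs k = Suc v" if "length zs = n" "t \<le> t'" "R t zs k = Suc v" for t t' zs k v
    using that
  proof (induction k arbitrary: v)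
    case 0
    then show ?case using stagewise_mono[OF F, of zs t v t'] by (simp add: R_def)
  next
    case (Suc k)
    then obtain u where u: "R t zs k = Suc u" "G (t # k # u # zs) = Suc v" by (auto simp: R_Suc)
    have "G (t' # k # u # zs) = Suc v" using stagewise_mono[OF G _ u(2) Suc.prems(2)] Suc.prems(1) by simp
    moreover have "R t' zs k = Suc u" using Suc.IH[OF Suc.prems(1,2) u(1)] .
    ultimately show ?case unfolding R_Suc by blast
  qed
  have iff: "prim_rec f g k zs = Some v \<longleftrightarrow> (\<exists>t. R t zs k = Suc v)" if zs: "length zs = n" for k zs v
  proof (induction k arbitrary: v)
    case 0
    show ?case using stagewise_iff[OF F zs] by (simp add: R_def prim_rec_def)
  next
    case (Suc k)
    have "prim_rec f g (Suc k) zs = Some v \<longleftrightarrow>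
        (\<exists>u. prim_rec f g k zs = Some u \<and> g (k # u # zs) = Some v)"
      by (simp add: prim_rec_def bind_eq_Some_conv)
    also have "\<dots> \<longleftrightarrow> (\<exists>u s t. R s zs k = Suc u \<and> G (t # k # u # zs) = Suc v)"
      using stagewise_iff[OF G, of "k # _ # zs"] zs by (simp add: Suc)
    also have "\<dots> \<longleftrightarrow> (\<exists>t u. R t zs k = Suc u \<and> G (t # k # u # zs) = Suc v)"
    proof
      assume "\<exists>u s t. R s zs k = Suc u \<and> G (t # k # u # zs) = Suc v"
      then obtain u s t where *: "R s zs k = Suc u" "G (t # k # u # zs) = Suc v" by blast
      have "R (max s t) zs k = Suc u" using mono[OF zs _ *(1)] by simp
      moreover have "G (max s t # k # u # zs) = Suc v" using stagewise_mono[OF G _ *(2)] zs by simp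
      ultimately show "\<exists>t u. R t zs k = Suc u \<and> G (t # k # u # zs) = Suc v" by blast
    qed blast
    finally show ?case by (simp add: R_Suc)
  qed
  show "?H (t' # xs) = Suc v" if "length xs = Suc n" "t \<le> t'" "?H (t # xs) = Suc v" for xs t t' v
  proof -
    from that(1) obtain k zs where xs: "xs = k # zs" "length zs = n" by (cases xs) auto
    show ?thesis using that(3) mono[OF xs(2) that(2)] unfolding xs(1) H by blast
  qed
  show "prim_rec f g (hd xs) (tl xs) = Some v \<longleftrightarrow> (\<exists>t. ?H (t # xs) = Suc v)"
    if "length xs = Suc n" for xs v
  proof -
    from that obtain k zs where xs: "xs = k # zs" "length zs = n" by (cases xs) auto
    show ?thesis unfolding xs(1) H unfolding list.sel using iff[OF xs(2)] .
  qed
qed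

lemma mu_search_eq_Some_iff:
  "mu_search f xs = Some k \<longleftrightarrow> f (k # xs) = Some 0 \<and> (\<forall>j<k. \<exists>v. f (j # xs) = Some (Suc v))"
    (is "_ \<longleftrightarrow> ?C k")
proof -
  have least: "(LEAST k. f (k # xs) = Some 0) = k" if "?C k" for k
    using that by (intro Least_equality) (auto simp: not_less[symmetric])
  show ?thesis
  proof
    assume "mu_search f xs = Some k"
    then obtain k' where "?C k'" "k = (LEAST k. f (k # xs) = Some 0)"
      by (auto simp: mu_search_def split: if_splits)
    with least show "?C k" by metis
  next
    assume "?C k"
    with least[OF this] show "mu_search f xs = Some k" unfolding mu_search_def by auto
  qed
qed

text \<open>
  At stage \<open>t\<close> only candidates \<open>k \<le> t\<close> are examined.  At most one candidate can satisfy the condition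
  in the sum, so the sum is \<open>Suc k\<close> for that candidate, or \<open>0\<close> if there is none yet.
\<close>

lemma stagewise_mu:
  assumes F: "stagewise (Suc n) F f"
  shows "stagewise n
    (\<lambda>ys. \<Sum>k<Suc (ys ! 0). if F (ys ! 0 # k # tl ys) = 1 \<and> (\<forall>j<k. 2 \<le> F (ys ! 0 # j # tl ys))
       then Suc k else 0)
    (mu_search f)" (is "stagewise _ ?H _")
proof (rule stagewiseI)
  have F': "total_recursive (Suc (Suc n)) F" using F by (rule stagewise_total_recursive)
  show "total_recursive (Suc n) ?H"
    by (intro recursive_intros total_recursive_subst[OF F']) auto
next
  define C where "C t xs k \<longleftrightarrow> F (t # k # xs) = 1 \<and> (\<forall>j<k. 2 \<le> F (t # j # xs))" for t xs k
  have C_unique: "k = k'" if "C t xs k" "C t xs k'" for t xs k k'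
    using that by (cases k k' rule: linorder_cases) (auto simp: C_def)
  have H: "?H (t # xs) = Suc k \<longleftrightarrow> C t xs k \<and> k \<le> t" for t xs k
  proof -
    have H_sum: "?H (t # xs) = (\<Sum>k<Suc t. if C t xs k then Suc k else 0)"
      by (simp add: C_def del: sum.lessThan_Suc)
    have eq: "?H (t # xs) = Suc k'" if "C t xs k'" "k' \<le> t" for k'
    proof -
      have "(\<Sum>k<Suc t. if C t xs k then Suc k else 0) = (\<Sum>k<Suc t. if k = k' then Suc k' else 0)"
        using that C_unique by (intro sum.cong) auto
      also have "\<dots> = Suc k'" using \<open>k' \<le> t\<close> by (simp del: sum.lessThan_Suc)
      finally show ?thesis using H_sum by simp
    qed
    show ?thesis
    proof
      assume "?H (t # xs) = Suc k"
      then have "(\<Sum>k<Suc t. if C t xs k then Suc k else 0) \<noteq> 0" unfolding H_sum[symmetric] by linarith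
      then obtain k' where "k' \<in> {..<Suc t}" "(if C t xs k' then Suc k' else 0) \<noteq> 0"
        by (rule sum.not_neutral_contains_not_neutral)
      then have "C t xs k'" "k' \<le> t" by (auto split: if_splits)
      with eq[OF this] \<open>?H (t # xs) = Suc k\<close> show "C t xs k \<and> k \<le> t" by simp
    qed (use eq in blast)
  qed
  have C_mono: "C t' xs k" if "C t xs k" "t \<le> t'" "length xs = n" for t t' xs k
  proof -
    have "2 \<le> F (t' # j # xs)" if "j < k" for j
    proof -
      obtain v where v: "F (t # j # xs) = Suc v" "1 \<le> v"
        using \<open>C t xs k\<close> \<open>j < k\<close> by (cases "F (t # j # xs)") (force simp: C_def)+
      then show ?thesis using stagewise_mono[OF F _ v(1) \<open>t \<le> t'\<close>] \<open>length xs = n\<close> by simp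
    qed
    moreover have "F (t' # k # xs) = 1"
      using stagewise_mono[OF F, of "k # xs" t 0 t'] that by (simp add: C_def)
    ultimately show ?thesis by (simp add: C_def)
  qed
  show "?H (t' # xs) = Suc v" if "length xs = n" "t \<le> t'" "?H (t # xs) = Suc v" for xs t t' v
    using that(3) C_mono[OF _ that(2,1), of v] that(2) unfolding H by linarith
  show "mu_search f xs = Some k \<longleftrightarrow> (\<exists>t. ?H (t # xs) = Suc k)" if xs: "length xs = n" for xs k
    unfolding H
  proof
    assume "mu_search f xs = Some k"
    then have k: "f (k # xs) = Some 0" and less: "\<And>j. j < k \<Longrightarrow> \<exists>v. f (j # xs) = Some (Suc v)"
      by (auto simp: mu_search_eq_Some_iff)
    obtain s where s: "F (s # k # xs) = Suc 0" using stagewise_iff[OF F, of "k # xs"] xs k by auto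
    have "\<exists>t. \<forall>j\<in>{..<k}. \<exists>v. F (t # j # xs) = Suc (Suc v)"
    proof (rule finite_common_stage)
      show "\<exists>t v. F (t # j # xs) = Suc (Suc v)" if j: "j \<in> {..<k}" for j
      proof -
        obtain v where "f (j # xs) = Some (Suc v)" using less[of j] j by auto
        then show ?thesis using stagewise_iff[OF F, of "j # xs" "Suc v"] xs by fastforce
      qed
      show "\<exists>v. F (t' # j # xs) = Suc (Suc v)"
        if "\<exists>v. F (t # j # xs) = Suc (Suc v)" "t \<le> t'" for j t t'
        using that stagewise_mono[OF F, of "j # xs" t _ t'] xs by fastforce
    qed simp
    then obtain t where t: "\<And>j. j < k \<Longrightarrow> \<exists>v. F (t # j # xs) = Suc (Suc v)" by auto
    let ?m = "max k (max s t)"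
    have "F (?m # k # xs) = 1" using stagewise_mono[OF F _ s] xs by simp
    moreover have "2 \<le> F (?m # j # xs)" if "j < k" for j
    proof -
      obtain v where v: "F (t # j # xs) = Suc (Suc v)" using t[OF \<open>j < k\<close>] ..
      have "F (?m # j # xs) = Suc (Suc v)" using xs by (intro stagewise_mono[OF F _ v]) auto
      then show ?thesis by simp
    qed
    ultimately show "\<exists>t. C t xs k \<and> k \<le> t" by (intro exI[of _ ?m]) (simp add: C_def)
  next
    assume "\<exists>t. C t xs k \<and> k \<le> t"
    then obtain t where t: "F (t # k # xs) = 1" "\<And>j. j < k \<Longrightarrow> 2 \<le> F (t # j # xs)"
      by (auto simp: C_def)
    have "f (k # xs) = Some 0" using stagewise_iff[OF F, of "k # xs"] xs t(1) by auto
    moreover have "\<exists>v. f (j # xs) = Some (Suc v)" if "j < k" for j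
    proof -
      have "F (t # j # xs) = Suc (Suc (F (t # j # xs) - 2))" using t(2)[OF that] by simp
      then show ?thesis using stagewise_iff[OF F, of "j # xs"] xs by auto
    qed
    ultimately show "mu_search f xs = Some k" by (simp add: mu_search_eq_Some_iff)
  qed
qed

theorem partial_recursive_stagewise: "partial_recursive n f \<Longrightarrow> \<exists>F. stagewise n F f"
proof (induction rule: partial_recursive.induct)
  case (zero n)
  show ?case using stagewise_of_total[OF total_recursive_const] by blast
next
  case succ
  have "total_recursive 1 (\<lambda>xs. Suc (hd xs))" using partial_recursive.succ by (simp add: total_recursive_def)
  then show ?case using stagewise_of_total by blast
next
  case (proj i n)
  then show ?case using stagewise_of_total[OF total_recursive_nth] by blast
next
  case (comp gs f n)
  then have "\<exists>G. \<forall>g\<in>set gs. stagewise n (G g) g" by (intro bchoice) blast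
  then obtain G where G: "\<And>g. g \<in> set gs \<Longrightarrow> stagewise n (G g) g" by blast
  obtain F where "stagewise (length gs) F f" using comp by blast
  then have "stagewise n (\<lambda>ys. if \<forall>g\<in>set gs. 0 < G g ys then F (ys ! 0 # map (\<lambda>g. G g ys - 1) gs) else 0)
    (\<lambda>xs. Option.bind (those (map (\<lambda>g. g xs) gs)) f)"
    using G by (rule stagewise_comp)
  then show ?case
    by (rule exI[where P = "\<lambda>H. stagewise n H (\<lambda>xs. Option.bind (those (map (\<lambda>g. g xs) gs)) f)"])
next
  case (prim n f g)
  then show ?case using stagewise_prim by blast
next
  case (mu n f)
  then show ?case using stagewise_mu by blast
next
  case (ext n f g)
  then obtain F where "stagewise n F f" by blast
  with ext(2) have "stagewise n F g" unfolding stagewise_def by simp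
  then show ?case by blast
qed

section \<open>Indices of Foelner sequences of a computable group\<close>

text \<open>
  Bound variables are pushed onto the front of the argument list, so the innermost variable \<open>c\<close> comes
  first and the free variable \<open>x\<close> last.
\<close>

lemma pi_sets_3_iff:
  "A \<in> pi_sets 3 \<longleftrightarrow>
     (\<exists>T. recursive_relation 4 T \<and> (\<forall>x. x \<in> A \<longleftrightarrow> (\<forall>a. \<exists>b. \<forall>c. T [c, b, a, x])))"
proof
  assume "A \<in> pi_sets 3"
  then obtain S1 S2 S3 where
      S1: "\<forall>xs. length xs = 1 \<longrightarrow> (xs ! 0 \<in> A \<longleftrightarrow> (\<forall>a. S1 (a # xs)))"
    and S2: "\<forall>xs. length xs = Suc 1 \<longrightarrow> (S1 xs \<longleftrightarrow> (\<exists>b. S2 (b # xs)))"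
    and S3: "\<forall>xs. length xs = Suc (Suc 1) \<longrightarrow> (S2 xs \<longleftrightarrow> (\<forall>c. S3 (c # xs)))"
    and rec: "recursive_relation (Suc (Suc (Suc 1))) S3"
    unfolding pi_sets_def numeral_3_eq_3 mem_Collect_eq sigma_relation.simps pi_relation.simps by blast
  have "x \<in> A \<longleftrightarrow> (\<forall>a. \<exists>b. \<forall>c. S3 [c, b, a, x])" for x
    using S1[rule_format, of "[x]"] S2[rule_format, of "[_, x]"] S3[rule_format, of "[_, _, x]"] by simp
  with rec show "\<exists>T. recursive_relation 4 T \<and> (\<forall>x. x \<in> A \<longleftrightarrow> (\<forall>a. \<exists>b. \<forall>c. T [c, b, a, x]))"
    by (auto simp: numeral_eq_Suc)
next
  assume "\<exists>T. recursive_relation 4 T \<and> (\<forall>x. x \<in> A \<longleftrightarrow> (\<forall>a. \<exists>b. \<forall>c. T [c, b, a, x]))"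
  then obtain T where T: "recursive_relation 4 T" "\<And>x. x \<in> A \<longleftrightarrow> (\<forall>a. \<exists>b. \<forall>c. T [c, b, a, x])"
    by blast
  have 1: "pi_relation (Suc 0) 3 (\<lambda>xs. \<forall>c. T (c # xs))"
    using T(1) by auto
  have 2: "sigma_relation (Suc (Suc 0)) 2 (\<lambda>xs. \<exists>b. \<forall>c. T (c # b # xs))"
    unfolding sigma_relation.simps(2)[of "Suc 0"] using 1
    by (intro exI[of _ "\<lambda>xs. \<forall>c. T (c # xs)"]) simp
  have "pi_relation (Suc (Suc (Suc 0))) 1 (\<lambda>xs. xs ! 0 \<in> A)"
    unfolding pi_relation.simps(2)[of "Suc (Suc 0)"]
  proof (intro exI conjI allI impI)
    show "sigma_relation (Suc (Suc 0)) (Suc 1) (\<lambda>xs. \<exists>b. \<forall>c. T (c # b # xs))"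
      using 2 by (simp only: numeral_2_eq_2 One_nat_def)
    show "xs ! 0 \<in> A \<longleftrightarrow> (\<forall>a. \<exists>b. \<forall>c. T (c # b # a # xs))" if "length xs = 1" for xs
    proof -
      from that have "xs = [xs ! 0]" by (cases xs) auto
      with T(2)[of "xs ! 0"] show ?thesis by simp
    qed
  qed
  then show "A \<in> pi_sets 3" by (simp only: pi_sets_def numeral_3_eq_3 mem_Collect_eq)
qed

text \<open>
  Testing convergence only against the bounds \<open>1 / k\<close> eliminates real numbers, so that the limit
  becomes an arithmetical condition.
\<close>

lemma ratio_tendsto_0_iff:
  fixes p q :: "nat \<Rightarrow> nat"
  assumes "\<And>j. 0 < q j"
  shows "(\<lambda>j. real (p j) / real (q j)) \<longlonglongrightarrow> 0 \<longleftrightarrow> (\<forall>k. \<exists>J. \<forall>j\<ge>J. k * p j \<le> q j)"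
proof
  assume lim: "(\<lambda>j. real (p j) / real (q j)) \<longlonglongrightarrow> 0"
  show "\<forall>k. \<exists>J. \<forall>j\<ge>J. k * p j \<le> q j"
  proof
    fix k
    have "0 < 1 / real (Suc k)" by simp
    from LIMSEQ_D[OF lim this] obtain J where
      J: "\<And>j. j \<ge> J \<Longrightarrow> real (p j) / real (q j) < 1 / real (Suc k)" by auto
    have "k * p j \<le> q j" if "j \<ge> J" for j
    proof -
      have "real (Suc k) * real (p j) < real (q j)"
        using J[OF that] assms[of j] by (simp add: field_simps)
      then have "Suc k * p j < q j" by (metis of_nat_less_iff of_nat_mult)
      then show ?thesis by simp
    qed
    then show "\<exists>J. \<forall>j\<ge>J. k * p j \<le> q j" by blast
  qed
next
  assume *: "\<forall>k. \<exists>J. \<forall>j\<ge>J. k * p j \<le> q j"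
  show "(\<lambda>j. real (p j) / real (q j)) \<longlonglongrightarrow> 0"
  proof (rule LIMSEQ_I)
    fix e :: real assume "0 < e"
    then obtain k where k: "1 / real (Suc k) < e" using nat_approx_posE by blast
    from * obtain J where J: "\<And>j. j \<ge> J \<Longrightarrow> Suc k * p j \<le> q j" by blast
    have "norm (real (p j) / real (q j) - 0) < e" if "j \<ge> J" for j
    proof -
      have "real (Suc k) * real (p j) \<le> real (q j)"
        using J[OF that] by (metis of_nat_le_iff of_nat_mult)
      then have "real (p j) / real (q j) \<le> 1 / real (Suc k)"
        using assms[of j] by (simp add: field_simps)
      with k show ?thesis by simp
    qed
    then show "\<exists>J. \<forall>j\<ge>J. norm (real (p j) / real (q j) - 0) < e" by blast
  qed
qed

text \<open>
  The cardinality of \<open>F - g F\<close> for the set \<open>F\<close> with canonical index \<open>n\<close>.  Since \<open>x \<in> g F\<close> is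
  equivalent to \<open>inv g \<otimes> x \<in> F\<close>, it can be counted by decidable membership tests on the elements of \<open>F\<close>.
\<close>

definition boundary_count :: "nat monoid \<Rightarrow> nat \<Rightarrow> nat \<Rightarrow> nat" where
  "boundary_count N g n = card {x \<in> set_decode n. inv\<^bsub>N\<^esub> g \<otimes>\<^bsub>N\<^esub> x \<notin> set_decode n}"

lemma (in group) l_coset_eq_inv_translate:
  assumes "g \<in> carrier G" "F \<subseteq> carrier G"
  shows "g <# F = {x \<in> carrier G. inv g \<otimes> x \<in> F}"
proof
  show "g <# F \<subseteq> {x \<in> carrier G. inv g \<otimes> x \<in> F}"
    using assms by (auto simp: l_coset_def m_assoc[symmetric] subset_iff)
  show "{x \<in> carrier G. inv g \<otimes> x \<in> F} \<subseteq> g <# F"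
  proof
    fix x assume x: "x \<in> {x \<in> carrier G. inv g \<otimes> x \<in> F}"
    then have "x = g \<otimes> (inv g \<otimes> x)" using assms by (simp add: m_assoc[symmetric])
    with x show "x \<in> g <# F" unfolding l_coset_def by blast
  qed
qed

lemma card_boundary_image:
  assumes N: "group N" "carrier N = UNIV" and G: "group G" and iso: "\<nu> \<in> iso N G"
  shows "card (\<nu> ` set_decode n - (\<nu> g <#\<^bsub>G\<^esub> (\<nu> ` set_decode n))) = boundary_count N g n"
proof -
  interpret group_hom N G \<nu>
    using N G iso by (simp add: group_hom_def group_hom_axioms_def iso_def)
  have inj: "inj \<nu>" using iso N(2) by (simp add: iso_def bij_betw_def)
  have coset: "\<nu> g <#\<^bsub>G\<^esub> (\<nu> ` set_decode n) =
      {x \<in> carrier G. inv\<^bsub>G\<^esub> (\<nu> g) \<otimes>\<^bsub>G\<^esub> x \<in> \<nu> ` set_decode n}"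
    using N by (intro H.l_coset_eq_inv_translate) auto
  have "\<nu> x \<in> \<nu> g <#\<^bsub>G\<^esub> (\<nu> ` set_decode n) \<longleftrightarrow> inv\<^bsub>N\<^esub> g \<otimes>\<^bsub>N\<^esub> x \<in> set_decode n" for x
  proof -
    have "inv\<^bsub>G\<^esub> (\<nu> g) \<otimes>\<^bsub>G\<^esub> \<nu> x = \<nu> (inv\<^bsub>N\<^esub> g \<otimes>\<^bsub>N\<^esub> x)" using N by simp
    moreover have "\<nu> x \<in> carrier G" using N by simp
    ultimately show ?thesis unfolding coset mem_Collect_eq by (simp only: inj_image_mem_iff[OF inj] simp_thms)
  qed
  then have "\<nu> ` set_decode n - (\<nu> g <#\<^bsub>G\<^esub> (\<nu> ` set_decode n)) =
      \<nu> ` {x \<in> set_decode n. inv\<^bsub>N\<^esub> g \<otimes>\<^bsub>N\<^esub> x \<notin> set_decode n}"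
    by auto
  then show ?thesis
    using inj by (simp add: boundary_count_def card_image inj_on_subset)
qed

lemma total_recursive_boundary_count:
  assumes N: "computable_enumerated_group N" and f: "total_recursive n f" "total_recursive n g"
  shows "total_recursive n (\<lambda>xs. boundary_count N (f xs) (g xs))"
proof (rule total_recursive_compose2[OF _ f])
  have mult: "total_recursive 2 (\<lambda>xs. xs ! 0 \<otimes>\<^bsub>N\<^esub> xs ! 1)"
    and inv: "total_recursive 1 (\<lambda>xs. inv\<^bsub>N\<^esub> (xs ! 0))"
    using N by (simp_all add: computable_enumerated_group_def computable1_iff computable2_iff)
  have "total_recursive 2 (\<lambda>xs. \<Sum>x<xs ! 1. if x \<in> set_decode (xs ! 1) \<and>
      inv\<^bsub>N\<^esub> (xs ! 0) \<otimes>\<^bsub>N\<^esub> x \<notin> set_decode (xs ! 1) then 1 else 0)"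
    by (intro recursive_intros total_recursive_compose2[OF mult] total_recursive_compose1[OF inv]) auto
  then show "total_recursive 2 (\<lambda>xs. boundary_count N (xs ! 0) (xs ! 1))"
    by (simp add: boundary_count_def card_set_decode_Collect)
qed

lemma partial_recursive1_section:
  assumes "partial_recursive2 \<phi>"
  shows "partial_recursive1 (\<phi> m)"
proof -
  have "partial_recursive 1 (\<lambda>xs. Option.bind
      (those (map (\<lambda>g. g xs) [\<lambda>xs. Some m, \<lambda>xs. Some (xs ! 0)])) (\<lambda>xs. \<phi> (xs ! 0) (xs ! 1)))"
    using assms total_recursive_const[of 1 m] total_recursive_nth[of 0 1]
    by (intro partial_recursive.comp)
      (auto simp: partial_recursive2_def total_recursive_def numeral_2_eq_2)
  then show ?thesis by (simp add: partial_recursive1_def)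
qed

lemma folner_sequence_image_iff:
  assumes N: "group N" "carrier N = UNIV" and G: "group G" and iso: "\<nu> \<in> iso N G"
  shows "folner_sequence G (\<lambda>j. \<nu> ` set_decode (n j)) \<longleftrightarrow>
    (\<forall>j. n j \<noteq> 0) \<and>
    (\<forall>g k. \<exists>J. \<forall>j\<ge>J. k * boundary_count N g (n j) \<le> card (set_decode (n j)))"
proof -
  have inj: "inj \<nu>" and bij: "bij_betw \<nu> UNIV (carrier G)"
    using iso N(2) by (auto simp: iso_def bij_betw_def)
  have card: "card (\<nu> ` set_decode m) = card (set_decode m)" for m
    using inj by (simp add: card_image inj_on_subset)
  have empty: "set_decode m = {} \<longleftrightarrow> m = 0" for m
    by (metis set_decode_inverse set_decode_zero set_encode_empty)
  have sub: "\<nu> ` set_decode m \<subseteq> carrier G" for m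
    using bij by (auto simp: bij_betw_def)
  have all: "(\<forall>g\<in>carrier G. P g) \<longleftrightarrow> (\<forall>g. P (\<nu> g))" for P
    using bij by (metis bij_betw_def rangeE rangeI)
  have "(\<forall>g. (\<lambda>j. real (boundary_count N g (n j)) / real (card (set_decode (n j)))) \<longlonglongrightarrow> 0) \<longleftrightarrow>
      (\<forall>g k. \<exists>J. \<forall>j\<ge>J. k * boundary_count N g (n j) \<le> card (set_decode (n j)))"
    if "\<forall>j. n j \<noteq> 0"
  proof -
    have pos: "0 < card (set_decode (n j))" for j
      using that empty by (simp add: card_gt_0_iff)
    show ?thesis using ratio_tendsto_0_iff[of "\<lambda>j. card (set_decode (n j))", OF pos] by simp
  qed
  then show ?thesis
    unfolding folner_sequence_def all card card_boundary_image[OF assms]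
    using sub by (auto simp: empty)
qed

text \<open>
  An index \<open>m\<close> belongs to the set if \<open>\<phi> m\<close> is total with nonzero values, which is a \<open>\<forall>\<exists>\<close>-condition, and
  if for all \<open>g\<close> and \<open>k\<close> there is \<open>J\<close> such that the values at all \<open>j \<ge> J\<close> satisfy the \<open>1 / k\<close>-estimate.
  As the function is total, the estimate at \<open>j\<close> may be demanded only at those stages at which
  the value at \<open>j\<close> is available; this keeps the innermost quantifier universal.  Both conditions are
  merged into one \<open>\<forall>\<exists>\<forall>\<close>-formula by pairing: \<open>a\<close> codes \<open>g\<close>, \<open>k\<close> and an argument \<open>i\<close> whose value
  must exist, \<open>b\<close> codes \<open>J\<close> and a halting stage for \<open>i\<close>, and \<open>c\<close> codes \<open>j\<close> and a stage.
\<close>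

theorem folner_indices_in_pi_sets_3:
  assumes \<phi>: "universal_function \<phi>" and G: "computable_group G \<nu>"
  shows "folner_indices \<phi> G \<nu> \<in> pi_sets 3"
proof -
  obtain N where N: "computable_enumerated_group N" and iso: "\<nu> \<in> iso N G" and "group G"
    using G by (auto simp: computable_group_def)
  then have group_N: "group N" "carrier N = UNIV" by (auto simp: computable_enumerated_group_def)
  have \<phi>_rec: "partial_recursive2 \<phi>" using \<phi> by (simp add: universal_function_def)
  then obtain \<Phi> where \<Phi>: "stagewise 2 \<Phi> (\<lambda>xs. \<phi> (xs ! 0) (xs ! 1))"
    unfolding partial_recursive2_def using partial_recursive_stagewise by blast
  have val: "\<phi> m j = Some v \<longleftrightarrow> (\<exists>t. \<Phi> [t, m, j] = Suc v)" for m j v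
    using stagewise_iff[OF \<Phi>, of "[m, j]"] by simp
  have \<Phi>_rec: "total_recursive (Suc (Suc (Suc 0))) \<Phi>"
    using stagewise_total_recursive[OF \<Phi>] by (simp add: numeral_2_eq_2)
  have index: "m \<in> folner_indices \<phi> G \<nu> \<longleftrightarrow>
      (\<exists>n. (\<forall>j. \<phi> m j = Some (n j)) \<and> (\<forall>j. n j \<noteq> 0) \<and>
        (\<forall>g k. \<exists>J. \<forall>j\<ge>J. k * boundary_count N g (n j) \<le> card (set_decode (n j))))" for m
  proof -
    have "computable1 n" if "\<forall>j. \<phi> m j = Some (n j)" for n
    proof -
      from that have "\<phi> m = (\<lambda>j. Some (n j))" by auto
      then show ?thesis using partial_recursive1_section[OF \<phi>_rec, of m] by (simp add: computable1_def)
    qed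
    then show ?thesis
      unfolding folner_indices_def computable_folner_sequence_def mem_Collect_eq
        folner_sequence_image_iff[OF group_N \<open>group G\<close> iso] by blast
  qed
  define g where "g a = fst (prod_decode a)" for a
  define k where "k a = fst (prod_decode (snd (prod_decode a)))" for a
  define i where "i a = snd (prod_decode (snd (prod_decode a)))" for a
  define T where "T xs \<longleftrightarrow>
      2 \<le> \<Phi> [snd (prod_decode (xs ! 1)), xs ! 3, i (xs ! 2)] \<and>
      (fst (prod_decode (xs ! 1)) \<le> fst (prod_decode (xs ! 0)) \<longrightarrow>
       0 < \<Phi> [snd (prod_decode (xs ! 0)), xs ! 3, fst (prod_decode (xs ! 0))] \<longrightarrow>
       k (xs ! 2) * boundary_count N (g (xs ! 2))
           (\<Phi> [snd (prod_decode (xs ! 0)), xs ! 3, fst (prod_decode (xs ! 0))] - 1)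
         \<le> card (set_decode (\<Phi> [snd (prod_decode (xs ! 0)), xs ! 3, fst (prod_decode (xs ! 0))] - 1)))"
    for xs
  have "recursive_relation 4 T"
    unfolding T_def g_def k_def i_def
    by (intro recursive_intros total_recursive_boundary_count[OF N] total_recursive_subst[OF \<Phi>_rec]) auto
  moreover have "m \<in> folner_indices \<phi> G \<nu> \<longleftrightarrow> (\<forall>a. \<exists>b. \<forall>c. T [c, b, a, m])" for m
  proof
    assume "m \<in> folner_indices \<phi> G \<nu>"
    then obtain n where n: "\<And>j. \<phi> m j = Some (n j)" "\<And>j. n j \<noteq> 0"
      "\<And>g k. \<exists>J. \<forall>j\<ge>J. k * boundary_count N g (n j) \<le> card (set_decode (n j))"
      unfolding index by blast
    show "\<forall>a. \<exists>b. \<forall>c. T [c, b, a, m]"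
    proof
      fix a
      obtain J where J: "\<And>j. j \<ge> J \<Longrightarrow> k a * boundary_count N (g a) (n j) \<le> card (set_decode (n j))"
        using n(3) by blast
      obtain t where t: "\<Phi> [t, m, i a] = Suc (n (i a))" using n(1) val by blast
      have "T [c, prod_encode (J, t), a, m]" for c
      proof -
        have "\<Phi> [s, m, j] - 1 = n j" if "0 < \<Phi> [s, m, j]" for s j
          using val[of m j "\<Phi> [s, m, j] - 1"] n(1)[of j] that by force
        then show ?thesis using J t n(2)[of "i a"] by (simp add: T_def)
      qed
      then show "\<exists>b. \<forall>c. T [c, b, a, m]" by blast
    qed
  next
    assume *: "\<forall>a. \<exists>b. \<forall>c. T [c, b, a, m]"
    have "\<exists>v. \<phi> m j = Some v \<and> v \<noteq> 0" for j
    proof -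
      obtain b where "T [0, b, prod_encode (0, prod_encode (0, j)), m]" using * by blast
      then have "2 \<le> \<Phi> [snd (prod_decode b), m, j]" by (simp add: T_def i_def)
      then have "\<Phi> [snd (prod_decode b), m, j] = Suc (\<Phi> [snd (prod_decode b), m, j] - 1)"
        "\<Phi> [snd (prod_decode b), m, j] - 1 \<noteq> 0" by auto
      then show ?thesis using val by blast
    qed
    then obtain n where n: "\<And>j. \<phi> m j = Some (n j)" "\<And>j. n j \<noteq> 0" by metis
    have "\<exists>J. \<forall>j\<ge>J. k' * boundary_count N g' (n j) \<le> card (set_decode (n j))" for g' k'
    proof -
      obtain b where b: "\<And>c. T [c, b, prod_encode (g', prod_encode (k', 0)), m]" using * by blast
      have "k' * boundary_count N g' (n j) \<le> card (set_decode (n j))" if "j \<ge> fst (prod_decode b)" for j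
      proof -
        obtain t where "\<Phi> [t, m, j] = Suc (n j)" using n(1) val by blast
        then show ?thesis using b[of "prod_encode (j, t)"] that by (simp add: T_def g_def k_def)
      qed
      then show ?thesis by blast
    qed
    with n show "m \<in> folner_indices \<phi> G \<nu>" unfolding index by blast
  qed
  ultimately show ?thesis unfolding pi_sets_3_iff by blast
qed

section \<open>The direct sum of infinite cyclic groups\<close>

lemma carrier_int_direct_sum: "carrier int_direct_sum = {z. finite {i. z i \<noteq> 0}}"
  by (simp add: int_direct_sum_def carrier_sum_group)

lemma mult_int_direct_sum: "z \<otimes>\<^bsub>int_direct_sum\<^esub> w = (\<lambda>i. z i + w i)"
  by (simp add: int_direct_sum_def restrict_UNIV)

lemma group_int_direct_sum: "group int_direct_sum"
  by (simp add: int_direct_sum_def)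

lemma one_int_direct_sum: "\<one>\<^bsub>int_direct_sum\<^esub> = (\<lambda>_. 0)"
  by (simp add: int_direct_sum_def restrict_UNIV)

lemma inv_int_direct_sum:
  assumes "z \<in> carrier int_direct_sum"
  shows "inv\<^bsub>int_direct_sum\<^esub> z = (\<lambda>i. - z i)"
proof (rule group.inv_equality[OF group_int_direct_sum])
  show "(\<lambda>i. - z i) \<in> carrier int_direct_sum" using assms by (simp add: carrier_int_direct_sum)
qed (simp_all add: mult_int_direct_sum one_int_direct_sum assms)

lemma int_seq_decode_in_carrier: "int_seq_decode c \<in> carrier int_direct_sum"
  using bij_betw_int_seq_decode by (auto simp: bij_betw_def)

text \<open>
  Passing to the tail strictly decreases a positive code.  Hence a code bounds the support of the
  sequence, and quantifiers over positions become bounded.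
\<close>

lemma int_seq_decode_beyond_code: "c \<le> i \<Longrightarrow> int_seq_decode c i = 0"
proof (induction i arbitrary: c)
  case 0
  then show ?case by (simp add: int_seq_decode_zero)
next
  case (Suc i)
  show ?case
  proof (cases "c = 0")
    case False
    then have "fst (prod_decode c) \<le> i" using fst_prod_decode_less[of c] Suc.prems by simp
    with Suc.IH show ?thesis by (simp add: int_seq_decode_Suc)
  qed (simp add: int_seq_decode_zero)
qed

text \<open>
  The group structure transported to codes.  Its operations are computable because the graph
  of addition on codes is recursive, so a sum can be found by search.
\<close>

definition int_seq_group :: "nat monoid" where
  "int_seq_group = \<lparr>carrier = UNIV,
     mult = (\<lambda>x y. inv_into UNIV int_seq_decode (\<lambda>i. int_seq_decode x i + int_seq_decode y i)), one = 0\<rparr>"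

lemma int_seq_decode_mult:
  "int_seq_decode (x \<otimes>\<^bsub>int_seq_group\<^esub> y) = int_seq_decode x \<otimes>\<^bsub>int_direct_sum\<^esub> int_seq_decode y"
proof -
  have "int_seq_decode x \<otimes>\<^bsub>int_direct_sum\<^esub> int_seq_decode y \<in> range int_seq_decode"
    using bij_betw_int_seq_decode group.is_monoid[OF group_int_direct_sum] int_seq_decode_in_carrier
    by (metis bij_betw_def monoid.m_closed)
  then show ?thesis
    by (simp add: int_seq_group_def f_inv_into_f mult_int_direct_sum)
qed

lemma group_int_seq_group: "group int_seq_group"
proof (rule groupI)
  interpret Z: group int_direct_sum by (rule group_int_direct_sum)
  have one: "int_seq_decode \<one>\<^bsub>int_seq_group\<^esub> = \<one>\<^bsub>int_direct_sum\<^esub>"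
    by (auto simp: int_seq_group_def one_int_direct_sum int_seq_decode_zero)
  note inj = injD[OF inj_int_seq_decode]
  fix x y z
  show "x \<otimes>\<^bsub>int_seq_group\<^esub> y \<otimes>\<^bsub>int_seq_group\<^esub> z = x \<otimes>\<^bsub>int_seq_group\<^esub> (y \<otimes>\<^bsub>int_seq_group\<^esub> z)"
    by (rule inj) (simp add: int_seq_decode_mult Z.m_assoc int_seq_decode_in_carrier)
  show "\<one>\<^bsub>int_seq_group\<^esub> \<otimes>\<^bsub>int_seq_group\<^esub> x = x"
    by (rule inj) (simp add: int_seq_decode_mult one int_seq_decode_in_carrier)
  have "inv\<^bsub>int_direct_sum\<^esub> (int_seq_decode x) \<in> range int_seq_decode"
    using bij_betw_int_seq_decode int_seq_decode_in_carrier by (metis Z.inv_closed bij_betw_def)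
  then obtain y where "int_seq_decode y = inv\<^bsub>int_direct_sum\<^esub> (int_seq_decode x)" by auto
  then have "y \<otimes>\<^bsub>int_seq_group\<^esub> x = \<one>\<^bsub>int_seq_group\<^esub>"
    by (intro inj) (simp add: int_seq_decode_mult one int_seq_decode_in_carrier)
  then show "\<exists>y\<in>carrier int_seq_group. y \<otimes>\<^bsub>int_seq_group\<^esub> x = \<one>\<^bsub>int_seq_group\<^esub>"
    by (auto simp: int_seq_group_def)
qed (simp_all add: int_seq_group_def)

text \<open>
  Positive and negative part of the integer with code \<open>e\<close>.  They turn equations between integers
  into equations between natural numbers.
\<close>

definition pos_code :: "nat \<Rightarrow> nat" where
  "pos_code e = (if even e then e div 2 else 0)"

definition neg_code :: "nat \<Rightarrow> nat" where
  "neg_code e = (if even e then 0 else Suc (e div 2))"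

lemma int_decode_eq_diff: "int_decode e = int (pos_code e) - int (neg_code e)"
  by (simp add: int_decode_def sum_decode_def pos_code_def neg_code_def)

lemma total_recursive_pos_code [recursive_intros]:
  assumes "total_recursive n f"
  shows "total_recursive n (\<lambda>xs. pos_code (f xs))"
  unfolding pos_code_def by (intro recursive_intros assms)

lemma total_recursive_neg_code [recursive_intros]:
  assumes "total_recursive n f"
  shows "total_recursive n (\<lambda>xs. neg_code (f xs))"
  unfolding neg_code_def by (intro recursive_intros assms)

lemma int_seq_decode_mult_iff:
  "int_seq_decode z = int_seq_decode x \<otimes>\<^bsub>int_direct_sum\<^esub> int_seq_decode y \<longleftrightarrow>
     (\<forall>i\<le>x + y + z. pos_code (entry_code x i) + pos_code (entry_code y i) + neg_code (entry_code z i)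
        = neg_code (entry_code x i) + neg_code (entry_code y i) + pos_code (entry_code z i))"
proof -
  have "int_seq_decode z = int_seq_decode x \<otimes>\<^bsub>int_direct_sum\<^esub> int_seq_decode y \<longleftrightarrow>
      (\<forall>i\<le>x + y + z. int_seq_decode z i = int_seq_decode x i + int_seq_decode y i)"
  proof
    assume *: "\<forall>i\<le>x + y + z. int_seq_decode z i = int_seq_decode x i + int_seq_decode y i"
    have "int_seq_decode z i = int_seq_decode x i + int_seq_decode y i" for i
      using * by (cases "i \<le> x + y + z") (simp_all add: int_seq_decode_beyond_code)
    then show "int_seq_decode z = int_seq_decode x \<otimes>\<^bsub>int_direct_sum\<^esub> int_seq_decode y"
      by (auto simp: mult_int_direct_sum)
  qed (simp add: mult_int_direct_sum)
  also have "\<dots> \<longleftrightarrow> (\<forall>i\<le>x + y + z.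
      pos_code (entry_code x i) + pos_code (entry_code y i) + neg_code (entry_code z i)
        = neg_code (entry_code x i) + neg_code (entry_code y i) + pos_code (entry_code z i))"
    by (rule all_cong) (simp add: int_seq_decode_entry_code int_decode_eq_diff, presburger)
  finally show ?thesis .
qed

lemma recursive_relation_int_seq_decode_mult [recursive_intros]:
  assumes "total_recursive n f" "total_recursive n g" "total_recursive n h"
  shows "recursive_relation n (\<lambda>xs. int_seq_decode (h xs) =
    int_seq_decode (f xs) \<otimes>\<^bsub>int_direct_sum\<^esub> int_seq_decode (g xs))"
proof -
  let ?P = "\<lambda>xs. \<forall>i\<le>xs ! 0 + xs ! 1 + xs ! 2.
      pos_code (entry_code (xs ! 0) i) + pos_code (entry_code (xs ! 1) i) + neg_code (entry_code (xs ! 2) i)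
        = neg_code (entry_code (xs ! 0) i) + neg_code (entry_code (xs ! 1) i) + pos_code (entry_code (xs ! 2) i)"
  have P: "recursive_relation 3 ?P" by (intro recursive_intros) auto
  have "recursive_map n 3 (\<lambda>xs. [f xs, g xs, h xs])"
    unfolding numeral_3_eq_3 by (intro recursive_intros assms)
  from recursive_relation_subst[OF P this] show ?thesis
    unfolding int_seq_decode_mult_iff by simp
qed

lemma Least_int_seq_decode: "(LEAST z. int_seq_decode z = int_seq_decode c) = c"
  by (intro Least_equality) (auto dest: injD[OF inj_int_seq_decode])

lemma computable_int_seq_group: "computable_enumerated_group int_seq_group"
proof -
  interpret N: group int_seq_group by (rule group_int_seq_group)
  have carrier: "carrier int_seq_group = UNIV" by (simp add: int_seq_group_def)
  have "total_recursive 2 (\<lambda>xs. LEAST z. int_seq_decode z =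
      int_seq_decode (xs ! 0) \<otimes>\<^bsub>int_direct_sum\<^esub> int_seq_decode (xs ! 1))"
  proof (intro recursive_intros)
    show "\<exists>z. int_seq_decode z = int_seq_decode (xs ! 0) \<otimes>\<^bsub>int_direct_sum\<^esub> int_seq_decode (xs ! 1)"
      for xs :: "nat list" using int_seq_decode_mult by blast
  qed auto
  then have "computable2 (\<lambda>x y. x \<otimes>\<^bsub>int_seq_group\<^esub> y)"
    by (simp add: computable2_iff int_seq_decode_mult[symmetric] Least_int_seq_decode)
  moreover have "computable1 (\<lambda>x. inv\<^bsub>int_seq_group\<^esub> x)"
  proof -
    have iff: "int_seq_decode 0 = int_seq_decode x \<otimes>\<^bsub>int_direct_sum\<^esub> int_seq_decode y \<longleftrightarrow>
        y = inv\<^bsub>int_seq_group\<^esub> x" for x y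
    proof -
      have "int_seq_decode 0 = int_seq_decode x \<otimes>\<^bsub>int_direct_sum\<^esub> int_seq_decode y \<longleftrightarrow>
          x \<otimes>\<^bsub>int_seq_group\<^esub> y = \<one>\<^bsub>int_seq_group\<^esub>"
        unfolding int_seq_decode_mult[symmetric]
        by (auto simp: int_seq_group_def dest: injD[OF inj_int_seq_decode])
      also have "\<dots> \<longleftrightarrow> y = inv\<^bsub>int_seq_group\<^esub> x"
        using N.inv_equality N.inv_comm carrier by (metis N.r_inv UNIV_I)
      finally show ?thesis .
    qed
    have "total_recursive 1 (\<lambda>xs. LEAST y. int_seq_decode 0 =
        int_seq_decode (xs ! 0) \<otimes>\<^bsub>int_direct_sum\<^esub> int_seq_decode y)"
    proof (intro recursive_intros)
      show "\<exists>y. int_seq_decode 0 = int_seq_decode (xs ! 0) \<otimes>\<^bsub>int_direct_sum\<^esub> int_seq_decode y"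
        for xs :: "nat list" unfolding iff by blast
    qed auto
    moreover have "(LEAST y. y = c) = c" for c :: nat by (rule Least_equality) auto
    ultimately show ?thesis unfolding iff computable1_iff by (simp only:)
  qed
  ultimately show ?thesis
    using group_int_seq_group carrier by (simp add: computable_enumerated_group_def)
qed

lemma computable_group_int_direct_sum: "computable_group int_direct_sum int_seq_decode"
proof -
  have "int_seq_decode \<in> iso int_seq_group int_direct_sum"
    using bij_betw_int_seq_decode int_seq_decode_in_carrier
    by (auto simp: iso_def hom_def int_seq_decode_mult) (simp add: int_seq_group_def)
  then show ?thesis
    using computable_int_seq_group group_int_direct_sum by (auto simp: computable_group_def)
qed

section \<open>Boxes in the direct sum\<close>

lemma (in group) l_coset_eq_image: "g <# F = (\<otimes>) g ` F"
  by (auto simp: l_coset_def)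

text \<open>
  A point of \<open>F\<close> outside \<open>g h F\<close> lies outside \<open>g F\<close>, or it is \<open>g y\<close> with \<open>y \<in> F\<close> outside \<open>h F\<close>.
  Together with the next lemma this reduces the Foelner condition to a set of generators.
\<close>

lemma (in group) card_diff_l_coset_mult_le:
  assumes "g \<in> carrier G" "h \<in> carrier G" "F \<subseteq> carrier G" "finite F"
  shows "card (F - ((g \<otimes> h) <# F)) \<le> card (F - (g <# F)) + card (F - (h <# F))"
proof -
  have "F - ((g \<otimes> h) <# F) \<subseteq> (F - (g <# F)) \<union> (\<otimes>) g ` (F - (h <# F))"
    unfolding lcos_m_assoc[OF assms(3,1,2), symmetric] by (auto simp: l_coset_eq_image)
  then have "card (F - ((g \<otimes> h) <# F)) \<le> card ((F - (g <# F)) \<union> (\<otimes>) g ` (F - (h <# F)))"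
    using assms(4) by (intro card_mono) auto
  also have "\<dots> \<le> card (F - (g <# F)) + card ((\<otimes>) g ` (F - (h <# F)))"
    by (rule card_Un_le)
  also have "card ((\<otimes>) g ` (F - (h <# F))) \<le> card (F - (h <# F))"
    using assms(4) by (intro card_image_le) auto
  finally show ?thesis by simp
qed

text \<open>
  Translation by \<open>g\<close> maps \<open>F - inv g F\<close> into \<open>g F - F\<close>, which is no larger than \<open>F - g F\<close>
  because \<open>g F\<close> has at most as many elements as \<open>F\<close>.
\<close>

lemma (in group) card_diff_l_coset_inv_le:
  assumes "g \<in> carrier G" "F \<subseteq> carrier G" "finite F"
  shows "card (F - (inv g <# F)) \<le> card (F - (g <# F))"
proof -
  have "card (F - (inv g <# F)) \<le> card ((g <# F) - F)"
  proof (rule card_inj_on_le)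
    show "inj_on ((\<otimes>) g) (F - (inv g <# F))"
      using inj_on_cmult[OF assms(1)] by (rule inj_on_subset) (use assms(2) in blast)
    have "x = inv g \<otimes> (g \<otimes> x)" if "x \<in> F" for x
      using that assms by (auto simp: m_assoc[symmetric])
    then show "(\<otimes>) g ` (F - (inv g <# F)) \<subseteq> (g <# F) - F"
      by (auto simp: l_coset_eq_image)
    show "finite ((g <# F) - F)" using assms(3) by (simp add: l_coset_eq_image)
  qed
  also have "\<dots> \<le> card (F - (g <# F))"
    using assms(3) by (intro card_le_sym_Diff) (simp_all add: l_coset_eq_image card_image_le)
  finally show ?thesis .
qed

definition unit_seq :: "nat \<Rightarrow> nat \<Rightarrow> int" where
  "unit_seq a = (\<lambda>i. if i = a then 1 else 0)"

lemma unit_seq_in_carrier: "unit_seq a \<in> carrier int_direct_sum"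
  by (simp add: carrier_int_direct_sum unit_seq_def)

text \<open>
  The unit sequences generate the direct sum: multiples of a unit sequence are handled by induction
  on the absolute value of the factor, and a finitely supported sequence is split into its last
  entry and the rest.
\<close>

lemma int_direct_sum_induct [consumes 1, case_names zero unit mult inv]:
  assumes "z \<in> carrier int_direct_sum"
    and zero: "P (\<lambda>_. 0)"
    and unit: "\<And>a. P (unit_seq a)"
    and mult: "\<And>z w. z \<in> carrier int_direct_sum \<Longrightarrow> w \<in> carrier int_direct_sum \<Longrightarrow> P z \<Longrightarrow> P w \<Longrightarrow>
      P (z \<otimes>\<^bsub>int_direct_sum\<^esub> w)"
    and inv: "\<And>z. z \<in> carrier int_direct_sum \<Longrightarrow> P z \<Longrightarrow> P (inv\<^bsub>int_direct_sum\<^esub> z)"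
  shows "P z"
proof -
  have single_carrier: "(\<lambda>i. if i = a then k else 0) \<in> carrier int_direct_sum" for a k
    by (simp add: carrier_int_direct_sum)
  have single_nat: "P (\<lambda>i. if i = a then int k else 0)" for a k
  proof (induction k)
    case 0
    show ?case using zero by (simp cong: if_cong)
  next
    case (Suc k)
    have "(\<lambda>i. if i = a then int (Suc k) else 0) =
        (\<lambda>i. if i = a then int k else 0) \<otimes>\<^bsub>int_direct_sum\<^esub> unit_seq a"
      by (auto simp: mult_int_direct_sum unit_seq_def)
    then show ?case using mult[OF single_carrier unit_seq_in_carrier Suc unit] by simp
  qed
  have single: "P (\<lambda>i. if i = a then k else 0)" for a k
  proof (cases "0 \<le> k")
    case True
    then have "int (nat k) = k" by simp
    with single_nat[of a "nat k"] show ?thesis by (simp only:)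
  next
    case False
    then have "(\<lambda>i. if i = a then k else 0) =
        inv\<^bsub>int_direct_sum\<^esub> (\<lambda>i. if i = a then int (nat (- k)) else 0)"
      unfolding inv_int_direct_sum[OF single_carrier] by auto
    then show ?thesis using inv[OF single_carrier[of a "int (nat (- k))"] single_nat] by (simp only:)
  qed
  have *: "(\<forall>i\<ge>n. z i = 0) \<longrightarrow> P z" for n z
  proof (induction n arbitrary: z)
    case 0
    have "z = (\<lambda>_. 0)" if "\<forall>i\<ge>0. z i = 0" using that by auto
    then show ?case using zero by blast
  next
    case (Suc n)
    show ?case
    proof
      assume z: "\<forall>i\<ge>Suc n. z i = 0"
      have eq: "z = z(n := 0) \<otimes>\<^bsub>int_direct_sum\<^esub> (\<lambda>i. if i = n then z n else 0)"
        by (auto simp: mult_int_direct_sum)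
      have tail: "(z(n := 0)) i = 0" if "n \<le> i" for i
        using z that by (cases "i = n") auto
      have "{i. (z(n := 0)) i \<noteq> 0} \<subseteq> {..<n}" using tail by (metis (mono_tags, lifting) lessThan_iff linorder_not_less mem_Collect_eq subsetI)
      then have "z(n := 0) \<in> carrier int_direct_sum"
        unfolding carrier_int_direct_sum mem_Collect_eq by (rule finite_subset) simp
      moreover have "P (z(n := 0))" using Suc.IH[of "z(n := 0)"] tail by blast
      ultimately have "P (z(n := 0) \<otimes>\<^bsub>int_direct_sum\<^esub> (\<lambda>i. if i = n then z n else 0))"
        using mult[OF _ single_carrier _ single] by blast
      then show "P z" by (subst eq)
    qed
  qed
  obtain n where "\<forall>i\<in>{i. z i \<noteq> 0}. i < n"
    using assms(1) unfolding carrier_int_direct_sum mem_Collect_eq finite_nat_set_iff_bounded by blast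
  then have "\<forall>i\<ge>n. z i = 0" by (metis (mono_tags) linorder_not_less mem_Collect_eq)
  with * show ?thesis by blast
qed

text \<open>
  There is no separate dimension: directions in which a finite box does not extend have side length
  \<open>1\<close>, which forces the coordinate to vanish.
\<close>

definition box :: "(nat \<Rightarrow> nat) \<Rightarrow> (nat \<Rightarrow> int) set" where
  "box L = {z. \<forall>i. 0 \<le> z i \<and> z i < int (L i)}"

lemma box_subset_carrier:
  assumes "\<And>i. n \<le> i \<Longrightarrow> L i = 1"
  shows "box L \<subseteq> carrier int_direct_sum"
proof
  fix z assume z: "z \<in> box L"
  have "z i = 0" if "n \<le> i" for i
  proof -
    have "0 \<le> z i \<and> z i < int (L i)" using z unfolding box_def by blast
    then show ?thesis using assms[OF that] by simp
  qed
  then have "{i. z i \<noteq> 0} \<subseteq> {..<n}"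
    by (metis (mono_tags, lifting) lessThan_iff linorder_not_less mem_Collect_eq subsetI)
  then show "z \<in> carrier int_direct_sum"
    unfolding carrier_int_direct_sum mem_Collect_eq by (rule finite_subset) simp
qed

text \<open>
  The boundary in direction \<open>a\<close> is contained in the face where coordinate \<open>a\<close> vanishes, and the box
  is the disjoint union of \<open>L a\<close> translates of that face.
\<close>

lemma card_box_boundary_le:
  assumes "finite (box L)"
  shows "L a * card (box L - (unit_seq a <#\<^bsub>int_direct_sum\<^esub> box L)) \<le> card (box L)"
proof -
  let ?S = "{z \<in> box L. z a = 0}"
  have "box L - (unit_seq a <#\<^bsub>int_direct_sum\<^esub> box L) \<subseteq> ?S"
  proof
    fix z assume z: "z \<in> box L - (unit_seq a <#\<^bsub>int_direct_sum\<^esub> box L)"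
    have "z a = 0"
    proof (rule ccontr)
      assume "z a \<noteq> 0"
      have range: "0 \<le> z i \<and> z i < int (L i)" for i using z unfolding box_def by blast
      have "0 \<le> (z(a := z a - 1)) i \<and> (z(a := z a - 1)) i < int (L i)" for i
        using range[of i] \<open>z a \<noteq> 0\<close> by (cases "i = a") auto
      then have "z(a := z a - 1) \<in> box L" unfolding box_def by blast
      moreover have "z = unit_seq a \<otimes>\<^bsub>int_direct_sum\<^esub> z(a := z a - 1)"
        by (auto simp: mult_int_direct_sum unit_seq_def)
      ultimately show False using z by (auto simp: l_coset_def)
    qed
    with z show "z \<in> ?S" by blast
  qed
  then have "card (box L - (unit_seq a <#\<^bsub>int_direct_sum\<^esub> box L)) \<le> card ?S"
    using assms by (intro card_mono) auto
  then have "L a * card (box L - (unit_seq a <#\<^bsub>int_direct_sum\<^esub> box L)) \<le> L a * card ?S"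
    by simp
  also have "\<dots> = card (?S \<times> {..<L a})" by (simp add: card_cartesian_product)
  also have "\<dots> \<le> card (box L)"
  proof (rule card_inj_on_le)
    show "inj_on (\<lambda>(z, k). z(a := int k)) (?S \<times> {..<L a})"
    proof (rule inj_onI, clarsimp)
      fix z w :: "nat \<Rightarrow> int" and k l
      assume zw: "z a = 0" "w a = 0" and eq: "z(a := int k) = w(a := int l)"
      have "z i = w i" for i using zw fun_cong[OF eq, of i] by (cases "i = a") auto
      moreover have "k = l" using fun_cong[OF eq, of a] by simp
      ultimately show "z = w \<and> k = l" by auto
    qed
    show "(\<lambda>(z, k). z(a := int k)) ` (?S \<times> {..<L a}) \<subseteq> box L" by (auto simp: box_def)
  qed (rule assms)
  finally show ?thesis .
qed

text \<open>
  A box of thickness \<open>1\<close> in direction \<open>a\<close> is disjoint from its translate in that direction.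
\<close>

lemma box_boundary_full:
  assumes "L a = 1"
  shows "box L - (unit_seq a <#\<^bsub>int_direct_sum\<^esub> box L) = box L"
proof -
  have "unit_seq a \<otimes>\<^bsub>int_direct_sum\<^esub> z \<notin> box L" if "z \<in> box L" for z
  proof
    assume "unit_seq a \<otimes>\<^bsub>int_direct_sum\<^esub> z \<in> box L"
    then have "1 + z a < int (L a)" by (auto simp: box_def mult_int_direct_sum unit_seq_def dest!: spec[of _ a])
    moreover have "0 \<le> z a" using that by (simp add: box_def)
    ultimately show False using assms by simp
  qed
  then show ?thesis by (auto simp: l_coset_def)
qed

theorem folner_sequence_boxes:
  assumes fin: "\<And>j. finite (box (L j))" and sub: "\<And>j. box (L j) \<subseteq> carrier int_direct_sum"
    and pos: "\<And>j i. 0 < L j i" and lim: "\<And>a k. \<exists>J. \<forall>j\<ge>J. k \<le> L j a"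
  shows "folner_sequence int_direct_sum (\<lambda>j. box (L j))"
proof -
  interpret group int_direct_sum by (rule group_int_direct_sum)
  have zero: "(\<lambda>_. 0) \<in> box (L j)" for j using pos by (simp add: box_def)
  then have card_pos: "0 < card (box (L j))" for j using fin card_gt_0_iff by blast
  note iff = ratio_tendsto_0_iff[of "\<lambda>j. card (box (L j))", OF card_pos]
  let ?p = "\<lambda>g j. card (box (L j) - (g <#\<^bsub>int_direct_sum\<^esub> box (L j)))"
  have "\<forall>k. \<exists>J. \<forall>j\<ge>J. k * ?p g j \<le> card (box (L j))" if "g \<in> carrier int_direct_sum" for g
    using that
  proof (induction g rule: int_direct_sum_induct)
    case zero
    have "\<one>\<^bsub>int_direct_sum\<^esub> <#\<^bsub>int_direct_sum\<^esub> box (L j) = box (L j)" for j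
      using sub by (rule lcos_mult_one)
    then show ?case by (simp add: one_int_direct_sum)
  next
    case (unit a)
    show ?case
    proof
      fix k
      obtain J where J: "\<And>j. j \<ge> J \<Longrightarrow> k \<le> L j a" using lim by blast
      have "k * ?p (unit_seq a) j \<le> card (box (L j))" if "j \<ge> J" for j
        using mult_le_mono1[OF J[OF that]] card_box_boundary_le[OF fin] by (rule order_trans)
      then show "\<exists>J. \<forall>j\<ge>J. k * ?p (unit_seq a) j \<le> card (box (L j))" by blast
    qed
  next
    case (mult z w)
    show ?case
    proof
      fix k
      \<comment> \<open>Each of the two boundaries may take up half of the allowed fraction.\<close>
      obtain J1 J2 where
          J1: "\<And>j. j \<ge> J1 \<Longrightarrow> (2 * k) * ?p z j \<le> card (box (L j))"
        and J2: "\<And>j. j \<ge> J2 \<Longrightarrow> (2 * k) * ?p w j \<le> card (box (L j))"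
        using mult.IH by metis
      have "k * ?p (z \<otimes>\<^bsub>int_direct_sum\<^esub> w) j \<le> card (box (L j))" if "j \<ge> max J1 J2" for j
      proof -
        have "?p (z \<otimes>\<^bsub>int_direct_sum\<^esub> w) j \<le> ?p z j + ?p w j"
          using mult.hyps sub fin by (rule card_diff_l_coset_mult_le)
        then have "k * ?p (z \<otimes>\<^bsub>int_direct_sum\<^esub> w) j \<le> k * ?p z j + k * ?p w j"
          by (metis add_mult_distrib2 mult_le_mono2)
        then show ?thesis using J1[of j] J2[of j] that by simp
      qed
      then show "\<exists>J. \<forall>j\<ge>J. k * ?p (z \<otimes>\<^bsub>int_direct_sum\<^esub> w) j \<le> card (box (L j))" by blast
    qed
  next
    case (inv z)
    have "?p (inv\<^bsub>int_direct_sum\<^esub> z) j \<le> ?p z j" for j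
      using inv.hyps sub fin by (rule card_diff_l_coset_inv_le)
    then show ?case using inv.IH by (meson mult_le_mono2 order_trans)
  qed
  then show ?thesis
    unfolding folner_sequence_def iff using fin sub zero by blast
qed

lemma not_folner_sequence_boxes:
  assumes "\<exists>\<^sub>\<infinity>j. L j a = 1"
  shows "\<not> folner_sequence int_direct_sum (\<lambda>j. box (L j))"
proof
  assume F: "folner_sequence int_direct_sum (\<lambda>j. box (L j))"
  let ?r = "\<lambda>j. real (card (box (L j) - (unit_seq a <#\<^bsub>int_direct_sum\<^esub> box (L j)))) / real (card (box (L j)))"
  have "?r \<longlonglongrightarrow> 0" using F unit_seq_in_carrier by (auto simp: folner_sequence_def)
  from LIMSEQ_D[OF this, of 1] obtain J where J: "\<And>j. j \<ge> J \<Longrightarrow> \<bar>?r j\<bar> < 1" by auto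
  obtain j where j: "j \<ge> J" "L j a = 1" using assms by (auto simp: INFM_nat_le)
  have "card (box (L j)) \<noteq> 0" using F by (auto simp: folner_sequence_def)
  then have "?r j = 1" using box_boundary_full[of "L j" a] j(2) by simp
  with J[OF j(1)] show False by simp
qed

subsection \<open>Codes of boxes\<close>

lemma entry_code_Suc: "entry_code c (Suc i) = entry_code (fst (prod_decode c)) i"
  by (simp add: entry_code_def funpow_Suc_right del: funpow.simps)

lemma entry_code_0: "entry_code c 0 = snd (prod_decode c)"
  by (simp add: entry_code_def)

text \<open>
  The largest code of a sequence of length \<open>n\<close> whose entries have codes at most \<open>K\<close>.
\<close>

definition seq_bound :: "nat \<Rightarrow> nat \<Rightarrow> nat" where
  "seq_bound K n = rec_nat 0 (\<lambda>_ b. prod_encode (b, K)) n"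

lemma prod_encode_mono:
  assumes "a \<le> a'" "b \<le> b'"
  shows "prod_encode (a, b) \<le> prod_encode (a', b')"
proof -
  have "mono triangle" by (rule incseq_SucI) simp
  then have "triangle (a + b) \<le> triangle (a' + b')" by (rule monoD) (use assms in simp)
  then show ?thesis using assms by (simp add: prod_encode_def)
qed

lemma code_le_seq_bound:
  assumes "\<And>i. entry_code c i \<le> K" "\<And>i. n \<le> i \<Longrightarrow> entry_code c i = 0"
  shows "c \<le> seq_bound K n"
  using assms
proof (induction n arbitrary: c)
  case 0
  then have "int_seq_decode c = int_seq_decode 0"
    by (intro HOL.ext) (simp add: int_seq_decode_zero, simp add: int_seq_decode_entry_code int_decode_zero)
  then have "c = 0" by (rule injD[OF inj_int_seq_decode])
  then show ?case by simp
next
  case (Suc n)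
  have "fst (prod_decode c) \<le> seq_bound K n"
  proof (rule Suc.IH)
    show "entry_code (fst (prod_decode c)) i \<le> K" for i
      using Suc.prems(1)[of "Suc i"] by (simp add: entry_code_Suc)
    show "entry_code (fst (prod_decode c)) i = 0" if "n \<le> i" for i
      using Suc.prems(2)[of "Suc i"] that by (simp add: entry_code_Suc)
  qed
  moreover have "snd (prod_decode c) \<le> K" using Suc.prems(1)[of 0] by (simp add: entry_code_0)
  ultimately have "prod_encode (fst (prod_decode c), snd (prod_decode c)) \<le> prod_encode (seq_bound K n, K)"
    by (rule prod_encode_mono)
  then show ?case by (simp add: seq_bound_def)
qed

text \<open>
  Nonnegative integers are exactly those with even codes, and \<open>z\<close> then has the code \<open>2 z\<close>.
\<close>

lemma int_decode_in_range_iff: "0 \<le> int_decode e \<and> int_decode e < int l \<longleftrightarrow> even e \<and> e < 2 * l"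
  by (auto simp: int_decode_eq_diff pos_code_def neg_code_def elim!: evenE)

lemma int_seq_decode_in_box_iff:
  "int_seq_decode c \<in> box L \<longleftrightarrow> (\<forall>i. even (entry_code c i) \<and> entry_code c i < 2 * L i)"
  by (simp add: box_def int_seq_decode_entry_code int_decode_in_range_iff)

lemma int_seq_decode_in_box_bounded_iff:
  assumes "\<And>i. 0 < L i"
  shows "int_seq_decode c \<in> box L \<longleftrightarrow> (\<forall>i<c. even (entry_code c i) \<and> entry_code c i < 2 * L i)"
     (is "_ \<longleftrightarrow> ?B")
proof
  assume B: ?B
  have "even (entry_code c i) \<and> entry_code c i < 2 * L i" for i
  proof (cases "i < c")
    case False
    then have "int_decode (entry_code c i) = int_decode 0"
      using int_seq_decode_beyond_code[of c i] by (simp add: int_seq_decode_entry_code int_decode_zero)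
    then have "entry_code c i = 0" unfolding int_decode_eq .
    then show ?thesis using assms by simp
  qed (use B in blast)
  then show "int_seq_decode c \<in> box L" by (simp add: int_seq_decode_in_box_iff)
qed (simp add: int_seq_decode_in_box_iff)

text \<open>
  The canonical index of a box whose side lengths are at most \<open>n + 1\<close> and equal \<open>1\<close> from position \<open>n\<close>
  on.  Entries of its elements are at most \<open>n\<close>, so their codes are at most \<open>2 n\<close>, and it
  suffices to search the sequence codes below the corresponding bound.
\<close>

definition box_code :: "(nat \<Rightarrow> nat) \<Rightarrow> nat \<Rightarrow> nat" where
  "box_code L n = (\<Sum>c<Suc (seq_bound (2 * n) n).
     if \<forall>i<c. even (entry_code c i) \<and> entry_code c i < 2 * L i then 2 ^ c else 0)"

lemma box_eq_image_box_code:
  assumes pos: "\<And>i. 0 < L i" and le: "\<And>i. L i \<le> Suc n" and tail: "\<And>i. n \<le> i \<Longrightarrow> L i = 1"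
  shows "box L = int_seq_decode ` set_decode (box_code L n)"
proof -
  let ?C = "{c. int_seq_decode c \<in> box L}"
  have sub: "?C \<subseteq> {..<Suc (seq_bound (2 * n) n)}"
  proof
    fix c assume "c \<in> ?C"
    then have c: "even (entry_code c i)" "entry_code c i < 2 * L i" for i
      by (simp_all add: int_seq_decode_in_box_iff)
    have "c \<le> seq_bound (2 * n) n"
    proof (rule code_le_seq_bound)
      show "entry_code c i \<le> 2 * n" for i using c[of i] le[of i] by (auto elim!: evenE)
      show "entry_code c i = 0" if "n \<le> i" for i using c[of i] tail[OF that] by (auto elim!: evenE)
    qed
    then show "c \<in> {..<Suc (seq_bound (2 * n) n)}" by simp
  qed
  then have fin: "finite ?C" by (rule finite_subset) simp
  have "box_code L n = (\<Sum>c<Suc (seq_bound (2 * n) n). if c \<in> ?C then 2 ^ c else 0)"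
    unfolding box_code_def int_seq_decode_in_box_bounded_iff[OF pos] mem_Collect_eq ..
  also have "\<dots> = (\<Sum>c\<in>{..<Suc (seq_bound (2 * n) n)} \<inter> ?C. 2 ^ c)"
    by (simp add: sum.inter_restrict del: sum.lessThan_Suc)
  also have "{..<Suc (seq_bound (2 * n) n)} \<inter> ?C = ?C" using sub by blast
  finally have "box_code L n = set_encode ?C" by (simp add: set_encode_def)
  then have "set_decode (box_code L n) = ?C" using fin by simp
  moreover have "box L \<subseteq> range int_seq_decode"
    using box_subset_carrier[OF tail] bij_betw_int_seq_decode by (auto simp: bij_betw_def)
  ultimately show ?thesis by auto
qed

section \<open>Reduction of the third level of the hierarchy\<close>

text \<open>
  Requiring that all candidates up to \<open>b\<close> have failed, and not only \<open>b\<close> itself, ensures that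
  either every \<open>b\<close> is refuted at some stage \<open>c\<close> or only finitely many are.
\<close>

definition refuted :: "(nat list \<Rightarrow> bool) \<Rightarrow> nat \<Rightarrow> nat \<Rightarrow> nat \<Rightarrow> nat \<Rightarrow> bool" where
  "refuted T x a b c \<longleftrightarrow> (\<forall>b'\<le>b. \<exists>c'\<le>c. \<not> T [c', b', a, x])"

text \<open>
  Each \<open>b\<close> contributes at most one event, namely at the pair of \<open>b\<close> and the first stage at which all
  candidates up to \<open>b\<close> have been refuted.  So there are finitely many events exactly if some
  candidate is never refuted.  In this way a \<open>\<exists>\<forall>\<close>-condition becomes the finiteness of a recursive set.
\<close>

definition refutation_event :: "(nat list \<Rightarrow> bool) \<Rightarrow> nat \<Rightarrow> nat \<Rightarrow> nat \<Rightarrow> bool" where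
  "refutation_event T x a j \<longleftrightarrow>
     refuted T x a (fst (prod_decode j)) (snd (prod_decode j)) \<and>
     (\<forall>c<snd (prod_decode j). \<not> refuted T x a (fst (prod_decode j)) c)"

lemma finite_refutation_event_iff:
  "finite {j. refutation_event T x a j} \<longleftrightarrow> (\<exists>b. \<forall>c. T [c, b, a, x])"
proof
  assume "\<exists>b. \<forall>c. T [c, b, a, x]"
  then obtain b0 where b0: "\<And>c. T [c, b0, a, x]" by blast
  have "{j. refutation_event T x a j} \<subseteq> (\<lambda>b. prod_encode (b, LEAST c. refuted T x a b c)) ` {..<b0}"
  proof
    fix j assume "j \<in> {j. refutation_event T x a j}"
    then have *: "refuted T x a (fst (prod_decode j)) (snd (prod_decode j))"
      "\<And>c. c < snd (prod_decode j) \<Longrightarrow> \<not> refuted T x a (fst (prod_decode j)) c"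
      by (simp_all add: refutation_event_def)
    have "(LEAST c. refuted T x a (fst (prod_decode j)) c) = snd (prod_decode j)"
      using * by (intro Least_equality) (auto intro!: leI)
    then have "j = prod_encode (fst (prod_decode j), LEAST c. refuted T x a (fst (prod_decode j)) c)"
      by simp
    moreover have "fst (prod_decode j) < b0"
      using *(1) b0 unfolding refuted_def by (metis not_less)
    ultimately show "j \<in> (\<lambda>b. prod_encode (b, LEAST c. refuted T x a b c)) ` {..<b0}" by blast
  qed
  then show "finite {j. refutation_event T x a j}" by (rule finite_subset) simp
next
  assume fin: "finite {j. refutation_event T x a j}"
  show "\<exists>b. \<forall>c. T [c, b, a, x]"
  proof (rule ccontr)
    assume "\<nexists>b. \<forall>c. T [c, b, a, x]"
    then have unbounded: "\<exists>c. \<exists>c'\<le>c. \<not> T [c', b, a, x]" for b by blast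
    have ex: "\<exists>c. refuted T x a b c" for b
    proof -
      have "\<exists>c. \<forall>b'\<in>{..b}. \<exists>c'\<le>c. \<not> T [c', b', a, x]"
        by (rule finite_common_stage) (use unbounded in \<open>auto intro: order_trans\<close>)
      then show ?thesis by (simp only: refuted_def Ball_def atMost_iff)
    qed
    let ?f = "\<lambda>b. prod_encode (b, LEAST c. refuted T x a b c)"
    have "refutation_event T x a (?f b)" for b
      using LeastI_ex[OF ex] not_less_Least by (auto simp: refutation_event_def)
    then have "range ?f \<subseteq> {j. refutation_event T x a j}" by blast
    then have "finite (range ?f)" using fin by (rule finite_subset)
    moreover have "inj ?f" by (rule injI) simp
    ultimately show False using finite_imageD by blast
  qed
qed

text \<open>
  The \<open>j\<close>-th box has side length \<open>j + 1\<close> in the first \<open>j\<close> directions, except that it collapses in direction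
  \<open>i\<close> whenever \<open>j\<close> is an event for \<open>i\<close>.  Hence the side length in direction \<open>i\<close> tends to infinity
  if there are finitely many events for \<open>i\<close>, and is \<open>1\<close> infinitely often otherwise.
\<close>

definition event_sides :: "(nat list \<Rightarrow> bool) \<Rightarrow> nat \<Rightarrow> nat \<Rightarrow> nat \<Rightarrow> nat" where
  "event_sides T x j i = (if i < j \<and> \<not> refutation_event T x i j then Suc j else 1)"

lemma total_recursive_box_code_event_sides:
  assumes T: "recursive_relation 4 T"
  shows "total_recursive 2 (\<lambda>xs. box_code (event_sides T (xs ! 0) (xs ! 1)) (xs ! 1))"
proof -
  have T': "recursive_relation (Suc (Suc (Suc (Suc 0)))) T" using T by (simp add: numeral_eq_Suc)
  show ?thesis
    unfolding box_code_def event_sides_def refutation_event_def refuted_def seq_bound_def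
    by (intro recursive_intros recursive_relation_subst[OF T']) auto
qed

lemma box_event_sides:
  "box (event_sides T x j) = int_seq_decode ` set_decode (box_code (event_sides T x j) j)"
  by (rule box_eq_image_box_code) (simp_all add: event_sides_def)

lemma folner_sequence_event_sides_iff:
  "folner_sequence int_direct_sum (\<lambda>j. box (event_sides T x j)) \<longleftrightarrow> (\<forall>a. \<exists>b. \<forall>c. T [c, b, a, x])"
proof
  assume F: "folner_sequence int_direct_sum (\<lambda>j. box (event_sides T x j))"
  have "finite {j. refutation_event T x a j}" for a
  proof (rule ccontr)
    assume "infinite {j. refutation_event T x a j}"
    then have "\<exists>\<^sub>\<infinity>j. refutation_event T x a j" by (simp add: frequently_cofinite)
    then have "\<exists>\<^sub>\<infinity>j. event_sides T x j a = 1"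
      by (rule frequently_elim1) (simp add: event_sides_def)
    with F not_folner_sequence_boxes show False by blast
  qed
  then show "\<forall>a. \<exists>b. \<forall>c. T [c, b, a, x]" by (simp add: finite_refutation_event_iff)
next
  assume *: "\<forall>a. \<exists>b. \<forall>c. T [c, b, a, x]"
  show "folner_sequence int_direct_sum (\<lambda>j. box (event_sides T x j))"
  proof (rule folner_sequence_boxes)
    show "finite (box (event_sides T x j))" for j by (simp add: box_event_sides)
    show "box (event_sides T x j) \<subseteq> carrier int_direct_sum" for j
      by (rule box_subset_carrier[of j]) (simp add: event_sides_def)
    show "0 < event_sides T x j i" for j i by (simp add: event_sides_def)
    show "\<exists>J. \<forall>j\<ge>J. k \<le> event_sides T x j a" for a k
    proof -
      have "finite {j. refutation_event T x a j}" using * by (simp add: finite_refutation_event_iff)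
      then obtain m where m: "\<And>j. refutation_event T x a j \<Longrightarrow> j < m"
        unfolding finite_nat_set_iff_bounded by blast
      have "k \<le> event_sides T x j a" if "j \<ge> max m (max k (Suc a))" for j
        using that m[of j] by (auto simp: event_sides_def)
      then show ?thesis by blast
    qed
  qed
qed

text \<open>
  The indices of the box sequences depend on \<open>x\<close> uniformly, so the s-m-n property turns \<open>x\<close> into an
  index of the sequence of boxes built from the refutation events for \<open>x\<close>.
\<close>

theorem folner_indices_int_direct_sum_hard:
  assumes \<phi>: "goedel_universal_function \<phi>" and "A \<in> pi_sets 3"
  shows "many_one_reducible A (folner_indices \<phi> int_direct_sum int_seq_decode)"
proof -
  obtain T where T: "recursive_relation 4 T" and A: "\<And>x. x \<in> A \<longleftrightarrow> (\<forall>a. \<exists>b. \<forall>c. T [c, b, a, x])"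
    using assms(2) unfolding pi_sets_3_iff by blast
  define n where "n x j = box_code (event_sides T x j) j" for x j
  have rec: "partial_recursive2 (\<lambda>x j. Some (n x j))"
    using total_recursive_box_code_event_sides[OF T]
    by (simp add: partial_recursive2_def total_recursive_def n_def)
  then obtain s where s: "computable1 s" "\<And>x. \<phi> (s x) = (\<lambda>j. Some (n x j))"
    using \<phi> unfolding goedel_universal_function_def by metis
  have "s x \<in> folner_indices \<phi> int_direct_sum int_seq_decode \<longleftrightarrow> x \<in> A" for x
  proof -
    have "computable1 (n x)" using partial_recursive1_section[OF rec, of x] by (simp add: computable1_def)
    moreover have "(\<forall>j. \<phi> (s x) j = Some (m j)) \<longleftrightarrow> m = n x" for m by (auto simp: s(2))
    ultimately have "s x \<in> folner_indices \<phi> int_direct_sum int_seq_decode \<longleftrightarrow>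
        folner_sequence int_direct_sum (\<lambda>j. box (event_sides T x j))"
      by (simp add: folner_indices_def computable_folner_sequence_def box_event_sides n_def[abs_def])
    then show ?thesis by (simp add: folner_sequence_event_sides_iff A)
  qed
  with s(1) show ?thesis unfolding many_one_reducible_def by blast
qed

theorem theorem2:
  fixes \<phi> :: "nat \<Rightarrow> nat \<rightharpoonup> nat"
    and G :: "('a, 'b) monoid_scheme"
    and \<nu> :: "nat \<Rightarrow> 'a"
  assumes "universal_function \<phi>"
  shows "(computable_group G \<nu> \<longrightarrow> folner_indices \<phi> G \<nu> \<in> pi_sets 3) \<and>
    (goedel_universal_function \<phi> \<longrightarrow>
       pi_complete 3 (folner_indices \<phi> int_direct_sum int_seq_decode))"
  using folner_indices_in_pi_sets_3[OF assms, of G \<nu>]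
    folner_indices_in_pi_sets_3[OF assms computable_group_int_direct_sum]
    folner_indices_int_direct_sum_hard[of \<phi>]
  unfolding pi_complete_def by blast

end
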